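(* Let $\mathrm{simp}_n(s,t)=\sum_{\sigma\in\mathrm{Simp}_n}s^{\mathrm{des}(\sigma)}t^{\mathrm{ides}(\sigma)}$, where $\mathrm{Simp}_n$ is the set of simple permutations of length $n$. Let \[ F(x)=F(x,s,t)=\sum_{n=1}^{\infty}\Bigl(\sum_{\pi\in S_n}s^{\mathrm{des}(\pi)}t^{\mathrm{ides}(\pi)}\Bigr)x^n, \] regarded as a formal power series in $x$ over the field $\mathbb{Q}(s,t)$, and let $F^{\langle -1\rangle}(u)=\sum_{n\ge 1}f_n^{\langle -1\rangle}(s,t)\,u^n$ be its functional (compositional) inverse. Then for all $n\ge 4$, \[ \mathrm{simp}_n(s,t)=-f_n^{\langle -1\rangle}(s,t)+(-1)^{n-1}+(-st)^{n-1}. \]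
   Context: For $\pi \in S_n$ (written in one-line notation), $\mathrm{des}(\pi)=|\{i\in\{1,\dots,n-1\} : \pi(i)>\pi(i+1)\}|$ and $\mathrm{ides}(\pi)=\mathrm{des}(\pi^{-1})$. A block of a permutation $a_1\ldots a_n$ is a nonempty contiguous sequence of entries $a_i a_{i+1}\ldots a_{i+k}$ whose values also form a contiguous sequence of integers. Singletons and the whole permutation are trivial blocks; all other blocks are proper. A permutation is simple if it has no proper blocks. *)

theory Defs
  imports
    "HOL-Combinatorics.Permutations"
    "HOL-Computational_Algebra.Computational_Algebra"
begin

text \<open>
  A permutation \<open>p\<close> of length \<open>n\<close> is a function with \<open>p permutes {1..n}\<close>;
  its one-line notation is \<open>p 1, ..., p n\<close>.
\<close>

definition des :: "nat \<Rightarrow> (nat \<Rightarrow> nat) \<Rightarrow> nat" where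
  "des n p = card {i \<in> {1..<n}. p i > p (i + 1)}"

definition ides :: "nat \<Rightarrow> (nat \<Rightarrow> nat) \<Rightarrow> nat" where
  "ides n p = des n (inv p)"

text \<open>A block \<open>p i, ..., p j\<close> is represented by its first and last positions \<open>i\<close> and \<open>j\<close>.\<close>

definition is_block :: "nat \<Rightarrow> (nat \<Rightarrow> nat) \<Rightarrow> nat \<Rightarrow> nat \<Rightarrow> bool" where
  "is_block n p i j \<longleftrightarrow> 1 \<le> i \<and> i \<le> j \<and> j \<le> n \<and> (\<exists>a b. p ` {i..j} = {a..b})"

definition proper_block :: "nat \<Rightarrow> (nat \<Rightarrow> nat) \<Rightarrow> nat \<Rightarrow> nat \<Rightarrow> bool" where
  "proper_block n p i j \<longleftrightarrow> is_block n p i j \<and> i \<noteq> j \<and> \<not> (i = 1 \<and> j = n)"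

definition Simp :: "nat \<Rightarrow> (nat \<Rightarrow> nat) set" where
  "Simp n = {p. p permutes {1..n} \<and> (\<nexists>i j. proper_block n p i j)}"

text \<open>
  The field of rational functions in \<open>s\<close> and \<open>t\<close> over the rationals is the fraction field of
  the polynomial ring in \<open>t\<close> whose coefficients are polynomials in \<open>s\<close>.
\<close>

type_synonym ratfun = "rat poly poly fract"

definition var_s :: ratfun where
  "var_s = Fract [:[:0, 1:]:] 1"

definition var_t :: ratfun where
  "var_t = Fract [:0, 1:] 1"

definition simp_poly :: "nat \<Rightarrow> ratfun" where
  "simp_poly n = (\<Sum>p\<in>Simp n. var_s ^ des n p * var_t ^ ides n p)"

text \<open>The sum defining the series starts at degree 1, hence the zero constant term.\<close>

definition F :: "ratfun fps" where
  "F = Abs_fps (\<lambda>n. if n = 0 then 0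
     else (\<Sum>p | p permutes {1..n}. var_s ^ des n p * var_t ^ ides n p))"

text \<open>
  \<open>F\<close> is therefore compositionally invertible, and \<open>fps_inv F\<close> is its two-sided inverse.
\<close>

lemma F_nth_0: "F $ 0 = 0"
  by (simp add: F_def)

lemma F_nth_1: "F $ 1 = 1"
proof -
  have "{p. p permutes {1..1::nat}} = {id}"
    by (auto simp: permutes_def fun_eq_iff) metis
  then show ?thesis
    by (simp add: F_def des_def ides_def)
qed

lemma fps_inv_F: "fps_inv F oo F = fps_X" "F oo fps_inv F = fps_X"
  using fps_inv[of F] fps_inv_right[of F] F_nth_0 F_nth_1 by simp_all

end

theory Submission
  imports Defs
begin

text \<open>
  Let \<open>\<mu>(\<pi>)\<close>, for \<open>\<pi>\<close> of length \<open>k\<close>, be the sum of \<open>(-1)^(k-1)\<close> if \<open>\<pi>\<close> is increasing,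
  \<open>(-1)^(k-1)\<close> if it is decreasing, \<open>-1\<close> if \<open>k = 1\<close>, and \<open>-1\<close> if \<open>\<pi>\<close> is simple and \<open>k \<ge> 3\<close>,
  and let \<open>G\<close> be the generating function of the permutations weighted by \<open>\<mu>(\<pi>) s^des t^ides\<close>.
  Descents and inverse descents add up under inflation of permutations, so the coefficient of
  \<open>x^n\<close> in \<open>G(F(x))\<close> is the sum of \<open>s^des(\<pi>) t^ides(\<pi>) \<mu>(\<pi>/B)\<close> over all \<open>\<pi>\<close> of length \<open>n\<close> and all
  partitions \<open>B\<close> of \<open>\<pi>\<close> into blocks, where \<open>\<pi>/B\<close> is the quotient permutation.
  For fixed \<open>\<pi>\<close> the increasing quotients contribute 1 if \<open>\<pi>\<close> is sum indecomposable and 0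
  otherwise, the decreasing quotients likewise for skew sums, and there is exactly one simple
  quotient of length at least 3 if \<open>\<pi>\<close> is indecomposable in both senses (and \<open>n \<ge> 2\<close>) and none
  otherwise. Hence the inner sum vanishes for \<open>n \<ge> 2\<close>, that is \<open>G(F(x)) = x\<close>, and the claim is
  read off the coefficients of \<open>G\<close>.

  Permutations are replaced by strict linear orders on finite sets of positions, for which
  quotients and restrictions to blocks need no standardization.
\<close>

subsection \<open>Linear orders and their gluing along blocks\<close>

definition linords :: "'a set \<Rightarrow> 'a rel set" where
  "linords A = {L. L \<subseteq> A \<times> A \<and> trans L \<and> irrefl L \<and> total_on A L}"

lemma linords_sub: "L \<in> linords A \<Longrightarrow> (x, y) \<in> L \<Longrightarrow> x \<in> A \<and> y \<in> A"
  by (auto simp: linords_def)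

lemma linords_trans: "L \<in> linords A \<Longrightarrow> (x, y) \<in> L \<Longrightarrow> (y, z) \<in> L \<Longrightarrow> (x, z) \<in> L"
  by (auto simp: linords_def trans_def)

lemma linords_irrefl: "L \<in> linords A \<Longrightarrow> (x, x) \<notin> L"
  by (auto simp: linords_def irrefl_def)

lemma linords_asym: "L \<in> linords A \<Longrightarrow> (x, y) \<in> L \<Longrightarrow> (y, x) \<notin> L"
  using linords_trans[of L A x y x] linords_irrefl[of L A x] by argo

lemma linords_total: "L \<in> linords A \<Longrightarrow> x \<in> A \<Longrightarrow> y \<in> A \<Longrightarrow> x \<noteq> y \<Longrightarrow> (x, y) \<in> L \<or> (y, x) \<in> L"
  by (simp add: linords_def total_on_def)

lemma finite_linords: "finite A \<Longrightarrow> finite (linords A)"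
  by (rule finite_subset[of _ "Pow (A \<times> A)"]) (auto simp: linords_def)

lemma linordsI:
  assumes "L \<subseteq> A \<times> A" "\<And>x y z. (x, y) \<in> L \<Longrightarrow> (y, z) \<in> L \<Longrightarrow> (x, z) \<in> L"
    "\<And>x. (x, x) \<notin> L"
    "\<And>x y. x \<in> A \<Longrightarrow> y \<in> A \<Longrightarrow> x \<noteq> y \<Longrightarrow> (x, y) \<in> L \<or> (y, x) \<in> L"
  shows "L \<in> linords A"
  using assms unfolding linords_def trans_def irrefl_def total_on_def by blast

lemma linords_converse: "L \<in> linords A \<Longrightarrow> L\<inverse> \<in> linords A"
  by (rule linordsI) (auto dest: linords_sub linords_irrefl linords_total intro: linords_trans)

lemma linords_minimal:
  assumes "L \<in> linords A" "finite A" "X \<subseteq> A" "X \<noteq> {}"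
  obtains m where "m \<in> X" "\<And>z. z \<in> X \<Longrightarrow> (z, m) \<notin> L"
proof -
  have "finite L" using assms(1,2) by (auto simp: linords_def intro: finite_subset)
  moreover have "acyclic L" using assms(1) by (simp add: linords_def acyclic_irrefl)
  ultimately have "wf L" by (rule finite_acyclic_wf)
  then obtain m where "m \<in> X" "\<And>z. (z, m) \<in> L \<Longrightarrow> z \<notin> X"
    using assms(4) by (metis wfE_min ex_in_conv)
  with that show ?thesis by blast
qed

lemma linords_maximal:
  assumes "L \<in> linords A" "finite A" "X \<subseteq> A" "X \<noteq> {}"
  obtains m where "m \<in> X" "\<And>z. z \<in> X \<Longrightarrow> (m, z) \<notin> L"
  using linords_minimal[OF linords_converse[OF assms(1)] assms(2-4)] by (metis converse_iff)

definition rst :: "'a rel \<Rightarrow> 'a set \<Rightarrow> 'a rel" where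
  "rst L X = L \<inter> X \<times> X"

lemma in_rst [simp]: "(x, y) \<in> rst L X \<longleftrightarrow> (x, y) \<in> L \<and> x \<in> X \<and> y \<in> X"
  by (simp add: rst_def)

lemma rst_linords: "L \<in> linords A \<Longrightarrow> X \<subseteq> A \<Longrightarrow> rst L X \<in> linords X"
  by (rule linordsI) (auto dest: linords_irrefl linords_total intro: linords_trans)

section \<open>Descents and their additivity under inflation\<close>

text \<open>With \<open>R\<close> the order of positions and \<open>S\<close> the order of values this is the
  number of descents; exchanging \<open>R\<close> and \<open>S\<close> yields the inverse descents.\<close>

definition covdesc :: "'a rel \<Rightarrow> 'a rel \<Rightarrow> ('a \<times> 'a) set" where
  "covdesc R S = {(x, y). (x, y) \<in> R \<and> (y, x) \<in> S \<and> \<not> (\<exists>z. (x, z) \<in> R \<and> (z, y) \<in> R)}"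

definition desc :: "'a rel \<Rightarrow> 'a rel \<Rightarrow> nat" where
  "desc R S = card (covdesc R S)"

lemma finite_covdesc: "finite A \<Longrightarrow> R \<in> linords A \<Longrightarrow> finite (covdesc R S)"
  by (rule finite_subset[of _ "A \<times> A"]) (auto simp: covdesc_def dest: linords_sub)

definition fib :: "('a \<Rightarrow> 'a) \<Rightarrow> 'a set \<Rightarrow> 'a \<Rightarrow> 'a set" where
  "fib \<rho> A r = {x \<in> A. \<rho> x = r}"

text \<open>A map \<open>\<rho>\<close> sends each element to the representative of its block; compatibility with an
  order says that the blocks are intervals of that order.\<close>

definition compat :: "('a \<Rightarrow> 'a) \<Rightarrow> 'a set \<Rightarrow> 'a rel \<Rightarrow> bool" where
  "compat \<rho> A L \<longleftrightarrow>
    (\<forall>x\<in>A. \<forall>y\<in>A. \<rho> x \<noteq> \<rho> y \<longrightarrow> ((x, y) \<in> L \<longleftrightarrow> (\<rho> x, \<rho> y) \<in> L))"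

lemma compatD: "compat \<rho> A L \<Longrightarrow> x \<in> A \<Longrightarrow> y \<in> A \<Longrightarrow> \<rho> x \<noteq> \<rho> y \<Longrightarrow> (x, y) \<in> L \<longleftrightarrow> (\<rho> x, \<rho> y) \<in> L"
  by (simp add: compat_def)

text \<open>Representatives are taken inside \<open>A\<close>, so the quotient of an order is its
  restriction to \<open>B\<close>; the blocks are the fibres \<open>fib \<rho> A r\<close>.\<close>

locale retraction =
  fixes \<rho> :: "'a \<Rightarrow> 'a" and A B :: "'a set"
  assumes fin: "finite A" and image: "\<rho> ` A = B" and BA: "B \<subseteq> A"
    and idem: "\<And>r. r \<in> B \<Longrightarrow> \<rho> r = r"
begin

lemma rho_in: "x \<in> A \<Longrightarrow> \<rho> x \<in> B"
  using image by auto

lemma finB: "finite B"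
  using fin image by auto

lemma fib_sub: "fib \<rho> A r \<subseteq> A"
  by (auto simp: fib_def)

lemma in_fib_self: "r \<in> B \<Longrightarrow> r \<in> fib \<rho> A r"
  using BA idem by (auto simp: fib_def)

text \<open>Blocks are intervals of \<open>R\<close>, so no element of another block separates two
  elements of a block: covering inside the block is covering in \<open>A\<close>.\<close>

lemma covdesc_same_fibre:
  assumes R: "R \<in> linords A" and cR: "compat \<rho> A R"
  shows "{(x, y) \<in> covdesc R S. \<rho> x = \<rho> y}
    = (\<Union>r\<in>B. covdesc (rst R (fib \<rho> A r)) (rst S (fib \<rho> A r)))"
proof (intro equalityI subsetI; clarify)
  fix x y assume xy: "(x, y) \<in> covdesc R S" "\<rho> x = \<rho> y"
  then have "x \<in> A" "y \<in> A" using linords_sub[OF R] by (auto simp: covdesc_def)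
  with xy have "(x, y) \<in> covdesc (rst R (fib \<rho> A (\<rho> x))) (rst S (fib \<rho> A (\<rho> x)))"
    by (auto simp: covdesc_def fib_def)
  with \<open>x \<in> A\<close> rho_in
  show "(x, y) \<in> (\<Union>r\<in>B. covdesc (rst R (fib \<rho> A r)) (rst S (fib \<rho> A r)))" by auto
next
  fix r x y assume r: "r \<in> B" and xy: "(x, y) \<in> covdesc (rst R (fib \<rho> A r)) (rst S (fib \<rho> A r))"
  then have xA: "x \<in> A" "y \<in> A" and rx: "\<rho> x = r" "\<rho> y = r" and R1: "(x, y) \<in> R" "(y, x) \<in> S"
    by (auto simp: covdesc_def fib_def)
  have "\<not> ((x, z) \<in> R \<and> (z, y) \<in> R)" for z
  proof
    assume z: "(x, z) \<in> R \<and> (z, y) \<in> R"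
    then have zA: "z \<in> A" using linords_sub[OF R] by auto
    show False
    proof (cases "\<rho> z = r")
      case True
      then show ?thesis using xy z zA xA rx by (auto simp: covdesc_def fib_def)
    next
      case False
      then have "(r, \<rho> z) \<in> R" "(\<rho> z, r) \<in> R"
        using z compatD[OF cR, of x z] compatD[OF cR, of z y] xA zA rx by auto
      then show ?thesis using linords_asym[OF R] by auto
    qed
  qed
  then show "(x, y) \<in> covdesc R S \<and> \<rho> x = \<rho> y" using R1 rx by (auto simp: covdesc_def)
qed

text \<open>A covering pair of \<open>R\<close> that leaves a block goes from its
  \<open>R\<close>-last element to the \<open>R\<close>-first element of the next block. It is thus
  determined by the two blocks, and compatibility with \<open>S\<close> makes it a descent exactly
  when the pair of representatives is one.\<close>

lemma covdesc_distinct_fibres: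
  assumes R: "R \<in> linords A" and cR: "compat \<rho> A R" and cS: "compat \<rho> A S"
  shows "bij_betw (map_prod \<rho> \<rho>) {(x, y) \<in> covdesc R S. \<rho> x \<noteq> \<rho> y} (covdesc (rst R B) (rst S B))"
proof (rule bij_betw_imageI)
  have aux: "x = x'" if "(x, y) \<in> covdesc R S" "(x', y') \<in> covdesc R S"
    "\<rho> x = \<rho> x'" "\<rho> y = \<rho> y'" "\<rho> x \<noteq> \<rho> y" for x y x' y'
  proof (rule ccontr)
    assume ne: "x \<noteq> x'"
    have mem: "x \<in> A" "y \<in> A" "x' \<in> A" "y' \<in> A" and r: "(x, y) \<in> R" "(x', y') \<in> R"
      using that linords_sub[OF R] by (auto simp: covdesc_def)
    have "(x', y) \<in> R" "(x, y') \<in> R" using compatD[OF cR] mem r that by metis+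
    then show False using that(1,2) linords_total[OF R mem(1,3) ne] by (auto simp: covdesc_def)
  qed
  have aux2: "y = y'" if "(x, y) \<in> covdesc R S" "(x', y') \<in> covdesc R S"
    "\<rho> x = \<rho> x'" "\<rho> y = \<rho> y'" "\<rho> x \<noteq> \<rho> y" for x y x' y'
  proof (rule ccontr)
    assume ne: "y \<noteq> y'"
    have mem: "x \<in> A" "y \<in> A" "x' \<in> A" "y' \<in> A" and r: "(x, y) \<in> R" "(x', y') \<in> R"
      using that linords_sub[OF R] by (auto simp: covdesc_def)
    have "(x', y) \<in> R" "(x, y') \<in> R" using compatD[OF cR] mem r that by metis+
    then show False using that(1,2) linords_total[OF R mem(2,4) ne] by (auto simp: covdesc_def)
  qed
  show "inj_on (map_prod \<rho> \<rho>) {(x, y) \<in> covdesc R S. \<rho> x \<noteq> \<rho> y}"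
    by (rule inj_onI) (auto intro: aux aux2)
  show "map_prod \<rho> \<rho> ` {(x, y) \<in> covdesc R S. \<rho> x \<noteq> \<rho> y} = covdesc (rst R B) (rst S B)"
  proof (intro equalityI subsetI)
    fix p assume "p \<in> map_prod \<rho> \<rho> ` {(x, y) \<in> covdesc R S. \<rho> x \<noteq> \<rho> y}"
    then obtain x y where p: "p = (\<rho> x, \<rho> y)" and xy: "(x, y) \<in> covdesc R S" "\<rho> x \<noteq> \<rho> y" by auto
    then have mem: "x \<in> A" "y \<in> A" and r: "(x, y) \<in> R" "(y, x) \<in> S"
      using linords_sub[OF R] by (auto simp: covdesc_def)
    have 1: "(\<rho> x, \<rho> y) \<in> R" "(\<rho> y, \<rho> x) \<in> S"
      using compatD[OF cR mem xy(2)] compatD[OF cS mem(2,1)] xy(2) r by auto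
    have "\<not> ((\<rho> x, b) \<in> R \<and> (b, \<rho> y) \<in> R)" if b: "b \<in> B" for b
    proof
      assume h: "(\<rho> x, b) \<in> R \<and> (b, \<rho> y) \<in> R"
      then have ne: "b \<noteq> \<rho> x" "b \<noteq> \<rho> y" using linords_irrefl[OF R] by auto
      have "b \<in> A" "\<rho> b = b" using b BA idem by auto
      then have "(x, b) \<in> R" "(b, y) \<in> R"
        using h ne compatD[OF cR mem(1), of b] compatD[OF cR _ mem(2), of b] by auto
      then show False using xy by (auto simp: covdesc_def)
    qed
    then show "p \<in> covdesc (rst R B) (rst S B)"
      using 1 mem rho_in p by (auto simp: covdesc_def)
  next
    fix p assume "p \<in> covdesc (rst R B) (rst S B)"
    then obtain b c where p: "p = (b, c)" and bc: "(b, c) \<in> covdesc (rst R B) (rst S B)"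
      by (cases p) auto
    then have B: "b \<in> B" "c \<in> B" and r: "(b, c) \<in> R" "(c, b) \<in> S" by (auto simp: covdesc_def)
    have ne: "b \<noteq> c" using r linords_irrefl[OF R] by auto
    \<comment> \<open>The preimage of \<open>(b, c)\<close> consists of the \<open>R\<close>-last
      element of the block of \<open>b\<close> and the \<open>R\<close>-first element of the block
      of \<open>c\<close>.\<close>
    obtain x where x: "x \<in> fib \<rho> A b" "\<And>z. z \<in> fib \<rho> A b \<Longrightarrow> (x, z) \<notin> R"
      using linords_maximal[OF R fin fib_sub] in_fib_self[OF B(1)] by (metis empty_iff)
    obtain y where y: "y \<in> fib \<rho> A c" "\<And>z. z \<in> fib \<rho> A c \<Longrightarrow> (z, y) \<notin> R"
      using linords_minimal[OF R fin fib_sub] in_fib_self[OF B(2)] by (metis empty_iff)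
    have mem: "x \<in> A" "y \<in> A" and rh: "\<rho> x = b" "\<rho> y = c" using x y by (auto simp: fib_def)
    have 1: "(x, y) \<in> R" "(y, x) \<in> S"
      using compatD[OF cR mem] compatD[OF cS mem(2,1)] rh r ne by auto
    have "\<not> ((x, z) \<in> R \<and> (z, y) \<in> R)" for z
    proof
      assume h: "(x, z) \<in> R \<and> (z, y) \<in> R"
      then have zA: "z \<in> A" using linords_sub[OF R] by auto
      have n: "\<rho> z \<noteq> b" "\<rho> z \<noteq> c" using h x y zA by (auto simp: fib_def)
      then have "(b, \<rho> z) \<in> R" "(\<rho> z, c) \<in> R"
        using h compatD[OF cR mem(1) zA] compatD[OF cR zA mem(2)] rh by auto
      then show False using bc B rho_in[OF zA] by (auto simp: covdesc_def)
    qed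
    then have "(x, y) \<in> covdesc R S" using 1 by (auto simp: covdesc_def)
    then show "p \<in> map_prod \<rho> \<rho> ` {(x, y) \<in> covdesc R S. \<rho> x \<noteq> \<rho> y}"
      using p rh ne by (intro image_eqI[of _ _ "(x, y)"]) auto
  qed
qed

text \<open>The pairs counted by \<open>desc R S\<close> either join two blocks or stay inside one.
  Taking the positions for \<open>R\<close> gives additivity of descents, taking the values for
  \<open>R\<close> that of inverse descents.\<close>

lemma desc_decompose:
  assumes R: "R \<in> linords A" and cR: "compat \<rho> A R" and cS: "compat \<rho> A S"
  shows "desc R S = desc (rst R B) (rst S B)
    + (\<Sum>r\<in>B. desc (rst R (fib \<rho> A r)) (rst S (fib \<rho> A r)))"
proof -
  have split: "covdesc R S = {(x, y) \<in> covdesc R S. \<rho> x \<noteq> \<rho> y} \<union> {(x, y) \<in> covdesc R S. \<rho> x = \<rho> y}"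
    by auto
  have f: "finite (covdesc R S)" by (rule finite_covdesc[OF fin R])
  have "card (covdesc R S) = card {(x, y) \<in> covdesc R S. \<rho> x \<noteq> \<rho> y} + card {(x, y) \<in> covdesc R S. \<rho> x = \<rho> y}"
    by (subst split, rule card_Un_disjoint) (auto intro: finite_subset[OF _ f])
  moreover have "card {(x, y) \<in> covdesc R S. \<rho> x \<noteq> \<rho> y} = card (covdesc (rst R B) (rst S B))"
    by (rule bij_betw_same_card[OF covdesc_distinct_fibres[OF assms]])
  moreover have "card {(x, y) \<in> covdesc R S. \<rho> x = \<rho> y}
    = (\<Sum>r\<in>B. card (covdesc (rst R (fib \<rho> A r)) (rst S (fib \<rho> A r))))"
    unfolding covdesc_same_fibre[OF R cR]
  proof (rule card_UN_disjoint[OF finB])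
    show "\<forall>r\<in>B. finite (covdesc (rst R (fib \<rho> A r)) (rst S (fib \<rho> A r)))"
      using finite_covdesc rst_linords[OF R fib_sub] finite_subset[OF fib_sub fin] by blast
  qed (auto simp: covdesc_def fib_def)
  ultimately show ?thesis by (simp add: desc_def)
qed

text \<open>This is the inflation of the quotient \<open>M\<close> by the orders \<open>N r\<close>,
  the inverse of passing to the quotient together with the restrictions to the blocks.\<close>

definition glue :: "'a rel \<Rightarrow> ('a \<Rightarrow> 'a rel) \<Rightarrow> 'a rel" where
  "glue M N = {(x, y) \<in> A \<times> A. if \<rho> x = \<rho> y then (x, y) \<in> N (\<rho> x) else (\<rho> x, \<rho> y) \<in> M}"

lemma glue_linords:
  assumes M: "M \<in> linords B" and N: "\<And>r. r \<in> B \<Longrightarrow> N r \<in> linords (fib \<rho> A r)"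
  shows "glue M N \<in> linords A"
proof (rule linordsI)
  show "glue M N \<subseteq> A \<times> A" by (auto simp: glue_def)
  show "(x, x) \<notin> glue M N" for x
    using linords_irrefl[OF N] rho_in by (auto simp: glue_def)
  show "(x, y) \<in> glue M N \<or> (y, x) \<in> glue M N" if "x \<in> A" "y \<in> A" "x \<noteq> y" for x y
    using that linords_total[OF N[of "\<rho> x"], of x y] linords_total[OF M, of "\<rho> x" "\<rho> y"] rho_in
    by (auto simp: glue_def fib_def)
  fix x y z assume h: "(x, y) \<in> glue M N" "(y, z) \<in> glue M N"
  then have mem: "x \<in> A" "y \<in> A" "z \<in> A" by (auto simp: glue_def)
  show "(x, z) \<in> glue M N"
  proof (cases "\<rho> x = \<rho> y \<and> \<rho> y = \<rho> z")
    case True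
    then show ?thesis using h mem linords_trans[OF N[of "\<rho> x"], of x y z] rho_in
      by (auto simp: glue_def)
  next
    case False
    then have "(\<rho> x, \<rho> z) \<in> M"
      using h linords_trans[OF M, of "\<rho> x" "\<rho> y" "\<rho> z"] by (auto simp: glue_def split: if_splits)
    then show ?thesis using mem linords_irrefl[OF M] by (auto simp: glue_def)
  qed
qed

lemma in_glue: "(x, y) \<in> glue M N \<longleftrightarrow>
    x \<in> A \<and> y \<in> A \<and> (if \<rho> x = \<rho> y then (x, y) \<in> N (\<rho> x) else (\<rho> x, \<rho> y) \<in> M)"
  by (auto simp: glue_def)

lemma rst_glue_base:
  assumes M: "M \<in> linords B" and N: "\<And>r. r \<in> B \<Longrightarrow> N r \<in> linords (fib \<rho> A r)"
  shows "rst (glue M N) B = M"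
proof -
  have "(x, y) \<in> rst (glue M N) B \<longleftrightarrow> (x, y) \<in> M" for x y
  proof (cases "x \<in> B \<and> y \<in> B")
    case True
    then have "x \<in> A" "y \<in> A" "\<rho> x = x" "\<rho> y = y" using BA idem by auto
    with True show ?thesis
      using linords_irrefl[OF N, of x x] linords_irrefl[OF M, of x] by (auto simp: in_glue)
  qed (use linords_sub[OF M] in auto)
  then show ?thesis by auto
qed

lemma rst_glue_fib:
  assumes "r \<in> B" and N: "\<And>r. r \<in> B \<Longrightarrow> N r \<in> linords (fib \<rho> A r)"
  shows "rst (glue M N) (fib \<rho> A r) = N r"
proof -
  have "(x, y) \<in> rst (glue M N) (fib \<rho> A r) \<longleftrightarrow> (x, y) \<in> N r" for x y
    using linords_sub[OF N[OF assms(1)], of x y] by (auto simp: in_glue fib_def)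
  then show ?thesis by auto
qed

lemma glue_compat:
  assumes M: "M \<in> linords B"
  shows "compat \<rho> A (glue M N)"
proof -
  have "\<rho> x \<in> A \<and> \<rho> (\<rho> x) = \<rho> x" if "x \<in> A" for x
    using rho_in[OF that] BA idem by auto
  then show ?thesis by (simp add: compat_def in_glue)
qed

lemma glue_rst:
  assumes L: "L \<in> linords A" and c: "compat \<rho> A L"
  shows "glue (rst L B) (\<lambda>r\<in>B. rst L (fib \<rho> A r)) = L"
proof -
  have "(x, y) \<in> glue (rst L B) (\<lambda>r\<in>B. rst L (fib \<rho> A r)) \<longleftrightarrow> (x, y) \<in> L" for x y
  proof (cases "x \<in> A \<and> y \<in> A")
    case True
    then show ?thesis using rho_in[of x] rho_in[of y] compatD[OF c, of x y]
      by (simp add: in_glue fib_def)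
  qed (use linords_sub[OF L] in \<open>auto simp: in_glue\<close>)
  then show ?thesis by auto
qed

text \<open>A compatible order amounts to a quotient order and an order on each block, all chosen
  independently. Distributivity then turns the sum over families of block orders into a product of
  sums.\<close>

lemma sum_compat:
  fixes f :: "'a rel \<Rightarrow> 'b :: comm_semiring_1" and g :: "'a \<Rightarrow> 'a rel \<Rightarrow> 'b"
  shows "(\<Sum>L | L \<in> linords A \<and> compat \<rho> A L. f (rst L B) * (\<Prod>r\<in>B. g r (rst L (fib \<rho> A r))))
    = (\<Sum>M\<in>linords B. f M) * (\<Prod>r\<in>B. \<Sum>N\<in>linords (fib \<rho> A r). g r N)"
proof -
  let ?P = "PiE B (\<lambda>r. linords (fib \<rho> A r))"
  have "(\<Sum>L | L \<in> linords A \<and> compat \<rho> A L. f (rst L B) * (\<Prod>r\<in>B. g r (rst L (fib \<rho> A r))))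
    = (\<Sum>(M, N)\<in>linords B \<times> ?P. f M * (\<Prod>r\<in>B. g r (N r)))"
  \<comment> \<open>The families are restricted to \<open>B\<close> so that they lie in the
    extensional product \<open>?P\<close>, where a family is determined by its values on
    \<open>B\<close>.\<close>
  proof (rule sum.reindex_bij_witness[where i = "\<lambda>(M, N). glue M N"
        and j = "\<lambda>L. (rst L B, \<lambda>r\<in>B. rst L (fib \<rho> A r))"])
    fix L assume "L \<in> {L. L \<in> linords A \<and> compat \<rho> A L}"
    then have L: "L \<in> linords A" "compat \<rho> A L" by auto
    then show "(case (rst L B, \<lambda>r\<in>B. rst L (fib \<rho> A r)) of (M, N) \<Rightarrow> glue M N) = L"
      by (simp add: glue_rst)
    show "(rst L B, \<lambda>r\<in>B. rst L (fib \<rho> A r)) \<in> linords B \<times> ?P"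
      using rst_linords[OF L(1)] BA fib_sub by auto
    show "(case (rst L B, \<lambda>r\<in>B. rst L (fib \<rho> A r)) of (M, N) \<Rightarrow> f M * (\<Prod>r\<in>B. g r (N r)))
      = f (rst L B) * (\<Prod>r\<in>B. g r (rst L (fib \<rho> A r)))"
      by simp
  next
    fix b assume "b \<in> linords B \<times> ?P"
    then obtain M N where b: "b = (M, N)" and M: "M \<in> linords B" and "N \<in> ?P" by auto
    then have N: "\<And>r. r \<in> B \<Longrightarrow> N r \<in> linords (fib \<rho> A r)" and e: "N \<in> extensional B"
      by (auto simp: PiE_def)
    have "(\<lambda>r\<in>B. rst (glue M N) (fib \<rho> A r)) = N"
      using rst_glue_fib[OF _ N] e by (auto simp: fun_eq_iff extensional_def)
    then show "(\<lambda>L. (rst L B, \<lambda>r\<in>B. rst L (fib \<rho> A r))) (case b of (M, N) \<Rightarrow> glue M N) = b"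
      using rst_glue_base[OF M N] b by simp
    show "(case b of (M, N) \<Rightarrow> glue M N) \<in> {L. L \<in> linords A \<and> compat \<rho> A L}"
      using glue_linords[OF M N] glue_compat[OF M] b by simp
  qed
  also have "\<dots> = (\<Sum>M\<in>linords B. f M) * (\<Sum>N\<in>?P. \<Prod>r\<in>B. g r (N r))"
    by (simp add: sum.cartesian_product[symmetric] sum_product)
  also have "(\<Sum>N\<in>?P. \<Prod>r\<in>B. g r (N r)) = (\<Prod>r\<in>B. \<Sum>N\<in>linords (fib \<rho> A r). g r N)"
    by (rule prod_sum_PiE[symmetric])
      (auto simp: finB intro!: finite_linords finite_subset[OF fib_sub fin])
  finally show ?thesis .
qed

end

subsection \<open>Linear orders as permutations\<close>

text \<open>Counting \<open>a\<close> itself makes ranks start at 1, as positions and values do in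
  one-line notation.\<close>

definition rank :: "'a rel \<Rightarrow> 'a set \<Rightarrow> 'a \<Rightarrow> nat" where
  "rank L A a = card {b \<in> A. (b, a) \<in> L \<or> b = a}"

lemma rank_less:
  assumes "L \<in> linords A" "finite A" "(a, b) \<in> L"
  shows "rank L A a < rank L A b"
  unfolding rank_def
proof (rule psubset_card_mono)
  have "b \<in> A" "b \<noteq> a" "(b, a) \<notin> L"
    using linords_sub[OF assms(1,3)] linords_irrefl[OF assms(1)] linords_asym[OF assms(1,3)] assms(3)
    by auto
  moreover have "{x \<in> A. (x, a) \<in> L \<or> x = a} \<subseteq> {x \<in> A. (x, b) \<in> L \<or> x = b}"
    using linords_trans[OF assms(1) _ assms(3)] assms(3) by auto
  ultimately show "{x \<in> A. (x, a) \<in> L \<or> x = a} \<subset> {x \<in> A. (x, b) \<in> L \<or> x = b}"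
    by auto
qed (simp add: assms)

lemma rank_less_iff:
  assumes "L \<in> linords A" "finite A" "a \<in> A" "b \<in> A"
  shows "rank L A a < rank L A b \<longleftrightarrow> (a, b) \<in> L"
proof
  assume r: "rank L A a < rank L A b"
  show "(a, b) \<in> L"
  proof (rule ccontr)
    assume "(a, b) \<notin> L"
    then have "a = b \<or> (b, a) \<in> L" using linords_total[OF assms(1,3,4)] by auto
    then have "rank L A b \<le> rank L A a" using rank_less[OF assms(1,2), of b a] by auto
    with r show False by simp
  qed
qed (rule rank_less[OF assms(1,2)])

lemma rank_inj_on:
  assumes "L \<in> linords A" "finite A"
  shows "inj_on (rank L A) A"
proof (rule inj_onI)
  fix x y assume m: "x \<in> A" "y \<in> A" and "rank L A x = rank L A y"
  then have "(x, y) \<notin> L" "(y, x) \<notin> L" using rank_less[OF assms] by fastforce+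
  then show "x = y" using linords_total[OF assms(1) m] by auto
qed

lemma rank_bij:
  assumes "L \<in> linords A" "finite A"
  shows "bij_betw (rank L A) A {1..card A}"
proof -
  have "rank L A x \<in> {1..card A}" if "x \<in> A" for x
  proof -
    have "{b \<in> A. (b, x) \<in> L \<or> b = x} \<noteq> {}" using that by auto
    then have "rank L A x > 0" using assms(2) by (simp add: rank_def card_gt_0_iff)
    moreover have "rank L A x \<le> card A" unfolding rank_def by (rule card_mono) (auto simp: assms)
    ultimately show ?thesis by simp
  qed
  then have "rank L A ` A \<subseteq> {1..card A}" by auto
  moreover have "card (rank L A ` A) = card {1..card A}"
    using card_image[OF rank_inj_on[OF assms]] by simp
  ultimately have "rank L A ` A = {1..card A}" by (simp add: card_subset_eq)
  then show ?thesis using rank_inj_on[OF assms] by (simp add: bij_betw_def)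
qed

text \<open>Covering pairs of \<open>R\<close> are the pairs of consecutive \<open>R\<close>-ranks,
  so the right-hand side counts the descents of the permutation that sends \<open>R\<close>-ranks to
  \<open>S\<close>-ranks.\<close>

lemma desc_rank:
  assumes R: "R \<in> linords A" and S: "S \<in> linords A" and A: "finite A"
  shows "desc R S = card {i \<in> {1..<card A}.
    rank S A (inv_into A (rank R A) i) > rank S A (inv_into A (rank R A) (i + 1))}"
proof -
  let ?f = "rank R A" and ?g = "rank S A" and ?n = "card A"
  let ?h = "inv_into A ?f"
  note bij = rank_bij[OF R A]
  have f: "?f x \<in> {1..?n}" "?h (?f x) = x" if "x \<in> A" for x
    using that bij by (auto simp: bij_betw_def inv_into_f_f)
  have h: "?h i \<in> A" "?f (?h i) = i" if "i \<in> {1..?n}" for i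
    using that bij by (auto simp: bij_betw_def inv_into_into f_inv_into_f)
  have cov: "covdesc R S = {(x, y). x \<in> A \<and> y \<in> A \<and> ?f y = ?f x + 1 \<and> ?g y < ?g x}"
  proof (intro equalityI subsetI; clarify)
    fix x y assume xy: "(x, y) \<in> covdesc R S"
    then have m: "x \<in> A" "y \<in> A" using linords_sub[OF R] by (auto simp: covdesc_def)
    have "?f x < ?f y" "?g y < ?g x"
      using xy rank_less[OF R A] rank_less[OF S A] by (auto simp: covdesc_def)
    moreover have "\<not> ?f x + 1 < ?f y"
    proof
      assume l: "?f x + 1 < ?f y"
      \<comment> \<open>If the ranks of \<open>x\<close> and \<open>y\<close> differed by more than
        1, the element of the next rank after \<open>x\<close> would lie strictly between
        them.\<close>
      let ?z = "?h (?f x + 1)"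
      have "?f x + 1 \<in> {1..?n}" using l f(1)[OF m(2)] by auto
      then have "?z \<in> A" "?f ?z = ?f x + 1" using h by auto
      then have "(x, ?z) \<in> R" "(?z, y) \<in> R"
        using rank_less_iff[OF R A] m l by (metis less_add_one)+
      then show False using xy by (auto simp: covdesc_def)
    qed
    ultimately show "x \<in> A \<and> y \<in> A \<and> ?f y = ?f x + 1 \<and> ?g y < ?g x" using m by auto
  next
    fix x y assume m: "x \<in> A" "y \<in> A" and fy: "?f y = ?f x + 1" and g: "?g y < ?g x"
    have "\<not> ((x, z) \<in> R \<and> (z, y) \<in> R)" for z
      using rank_less[OF R A, of x z] rank_less[OF R A, of z y] fy by auto
    then show "(x, y) \<in> covdesc R S"
      using m fy g rank_less_iff[OF R A m] rank_less_iff[OF S A m(2,1)] by (auto simp: covdesc_def)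
  qed
  have "bij_betw (\<lambda>(x, y). ?f x) (covdesc R S) {i \<in> {1..<?n}. ?g (?h i) > ?g (?h (i + 1))}"
  proof (rule bij_betw_byWitness[where f' = "\<lambda>i. (?h i, ?h (i + 1))"])
    show "\<forall>p\<in>covdesc R S. (?h (case p of (x, y) \<Rightarrow> ?f x), ?h ((case p of (x, y) \<Rightarrow> ?f x) + 1)) = p"
    proof clarify
      fix x y assume "(x, y) \<in> covdesc R S"
      then have "x \<in> A" "y \<in> A" "?f y = ?f x + 1" using cov by auto
      then show "?h (?f x) = x \<and> ?h (?f x + 1) = y" using f(2) by metis
    qed
    show "\<forall>i\<in>{i \<in> {1..<?n}. ?g (?h i) > ?g (?h (i + 1))}. (case (?h i, ?h (i + 1)) of (x, y) \<Rightarrow> ?f x) = i"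
      using h by auto
    show "(\<lambda>(x, y). ?f x) ` covdesc R S \<subseteq> {i \<in> {1..<?n}. ?g (?h i) > ?g (?h (i + 1))}"
    proof clarify
      fix x y assume "(x, y) \<in> covdesc R S"
      then have m: "x \<in> A" "y \<in> A" "?f y = ?f x + 1" "?g y < ?g x" using cov by auto
      then have "?h (?f x) = x" "?h (?f x + 1) = y" using f(2) by metis+
      then show "?f x \<in> {1..<?n} \<and> ?g (?h (?f x)) > ?g (?h (?f x + 1))"
        using m f(1)[OF m(1)] f(1)[OF m(2)] by auto
    qed
    show "(\<lambda>i. (?h i, ?h (i + 1))) ` {i \<in> {1..<?n}. ?g (?h i) > ?g (?h (i + 1))} \<subseteq> covdesc R S"
      unfolding cov using h by auto
  qed
  then show ?thesis unfolding desc_def by (rule bij_betw_same_card)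
qed

section \<open>Intervals, blocks and the standardization of an order\<close>

definition interval :: "'a rel \<Rightarrow> 'a set \<Rightarrow> bool" where
  "interval M I \<longleftrightarrow> (\<forall>x\<in>I. \<forall>y\<in>I. \<forall>z. (x, z) \<in> M \<longrightarrow> (z, y) \<in> M \<longrightarrow> z \<in> I)"

lemma intervalD: "interval M I \<Longrightarrow> x \<in> I \<Longrightarrow> y \<in> I \<Longrightarrow> (x, z) \<in> M \<Longrightarrow> (z, y) \<in> M \<Longrightarrow> z \<in> I"
  unfolding interval_def by blast

lemma intervalI:
  "(\<And>x y z. x \<in> I \<Longrightarrow> y \<in> I \<Longrightarrow> (x, z) \<in> M \<Longrightarrow> (z, y) \<in> M \<Longrightarrow> z \<in> I) \<Longrightarrow> interval M I"
  unfolding interval_def by blast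

text \<open>Ranks form a monotone bijection onto \<open>{1..card A}\<close>, so intervals of the
  order turn into the sets \<open>{a..b}\<close> that \<open>is_block\<close> speaks of.\<close>

lemma interval_iff_rank:
  assumes L: "L \<in> linords A" and A: "finite A" and I: "I \<subseteq> A" "I \<noteq> {}"
  shows "interval L I \<longleftrightarrow> (\<exists>a b. rank L A ` I = {a..b})"
proof
  let ?g = "rank L A"
  assume int: "interval L I"
  have fin: "finite (?g ` I)" by (intro finite_imageI finite_subset[OF I(1) A])
  have "?g ` I = {Min (?g ` I)..Max (?g ` I)}"
  proof (intro equalityI subsetI)
    fix k assume k: "k \<in> {Min (?g ` I)..Max (?g ` I)}"
    have "Min (?g ` I) \<in> ?g ` I" "Max (?g ` I) \<in> ?g ` I" using fin I(2) by auto
    then obtain x y where x: "x \<in> I" "?g x = Min (?g ` I)" and y: "y \<in> I" "?g y = Max (?g ` I)"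
      by (elim imageE) simp
    have "?g x \<in> {1..card A}" "?g y \<in> {1..card A}"
      using bij_betwE[OF rank_bij[OF L A]] x(1) y(1) I(1) by auto
    then have "k \<in> {1..card A}" using k x y by auto
    then obtain z where z: "z \<in> A" "?g z = k"
      using bij_betw_imp_surj_on[OF rank_bij[OF L A]] by (metis imageE)
    have "z \<in> I"
    proof (cases "k = ?g x \<or> k = ?g y")
      case True
      then have "?g z = ?g x \<or> ?g z = ?g y" using z by simp
      then show ?thesis using inj_onD[OF rank_inj_on[OF L A], of z] z(1) x(1) y(1) I(1) by blast
    next
      case False
      then have "?g x < ?g z" "?g z < ?g y" using k x y z by auto
      moreover have "x \<in> A" "y \<in> A" using x y I(1) by auto
      ultimately have "(x, z) \<in> L" "(z, y) \<in> L"
        using rank_less_iff[OF L A] z(1) by simp_all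
      then show ?thesis by (rule intervalD[OF int x(1) y(1)])
    qed
    then show "k \<in> ?g ` I" using z by auto
  qed (use fin in auto)
  then show "\<exists>a b. ?g ` I = {a..b}" by blast
next
  assume "\<exists>a b. rank L A ` I = {a..b}"
  then obtain a b where ab: "rank L A ` I = {a..b}" by blast
  show "interval L I"
  proof (rule intervalI)
    fix x y z assume x: "x \<in> I" and y: "y \<in> I" and r: "(x, z) \<in> L" "(z, y) \<in> L"
    have "rank L A x \<in> {a..b}" "rank L A y \<in> {a..b}" using ab x y by blast+
    then have "rank L A z \<in> rank L A ` I"
      using rank_less[OF L A r(1)] rank_less[OF L A r(2)] ab by auto
    then obtain w where "w \<in> I" "rank L A z = rank L A w" by auto
    moreover have "z \<in> A" using linords_sub[OF L r(1)] by auto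
    ultimately show "z \<in> I" using I(1) inj_onD[OF rank_inj_on[OF L A], of z w] by auto
  qed
qed

definition pos :: "nat set \<Rightarrow> nat rel" where
  "pos A = {(x, y) \<in> A \<times> A. x < y}"

lemma in_pos [simp]: "(x, y) \<in> pos A \<longleftrightarrow> x \<in> A \<and> y \<in> A \<and> x < y"
  by (simp add: pos_def)

lemma pos_linords: "pos A \<in> linords A"
  by (rule linordsI) (auto simp: pos_def)

lemma rst_pos: "B \<subseteq> A \<Longrightarrow> rst (pos A) B = pos B"
  by (auto simp: pos_def rst_def)

definition wt :: "nat set \<Rightarrow> nat rel \<Rightarrow> ratfun" where
  "wt A L = var_s ^ desc (pos A) L * var_t ^ desc L (pos A)"

text \<open>The sets \<open>I\<close> are the blocks, intervals of both positions and values. The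
  alternative \<open>card I \<le> 1\<close> covers singletons and also the empty set, which is an
  interval of every order.\<close>

definition simple :: "nat set \<Rightarrow> nat rel \<Rightarrow> bool" where
  "simple A L \<longleftrightarrow> (\<forall>I\<subseteq>A. interval (pos A) I \<and> interval L I \<longrightarrow> card I \<le> 1 \<or> I = A)"

text \<open>This is the standardization of \<open>L\<close>. It is the identity outside
  \<open>{1..card A}\<close> because \<open>permutes\<close> demands that.\<close>

definition perm_of :: "nat set \<Rightarrow> nat rel \<Rightarrow> nat \<Rightarrow> nat" where
  "perm_of A L i =
    (if i \<in> {1..card A} then rank L A (inv_into A (rank (pos A) A) i) else i)"

lemma perm_of_permutes:
  assumes L: "L \<in> linords A" and A: "finite A"
  shows "perm_of A L permutes {1..card A}"
proof (rule bij_imp_permutes)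
  have "bij_betw (rank L A \<circ> inv_into A (rank (pos A) A)) {1..card A} {1..card A}"
    by (rule bij_betw_trans[OF bij_betw_inv_into[OF rank_bij[OF pos_linords A]] rank_bij[OF L A]])
  then show "bij_betw (perm_of A L) {1..card A} {1..card A}"
    by (subst bij_betw_cong[of _ _ "rank L A \<circ> inv_into A (rank (pos A) A)"]) (auto simp: perm_of_def)
qed (auto simp: perm_of_def)

lemma perm_of_rank_pos:
  assumes A: "finite A" and "x \<in> A"
  shows "perm_of A L (rank (pos A) A x) = rank L A x"
  using rank_bij[OF pos_linords A] assms
  by (auto simp: perm_of_def bij_betw_def inv_into_f_f)

text \<open>An order is recovered from its ranks, which gives injectivity. For surjectivity, a
  permutation \<open>p\<close> is pulled back to the order of \<open>A\<close> by the values of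
  \<open>p\<close> at the ranks of the positions.\<close>

lemma perm_of_bij:
  assumes A: "finite A"
  shows "bij_betw (perm_of A) (linords A) {p. p permutes {1..card A}}"
proof (rule bij_betw_imageI)
  let ?c = "rank (pos A) A"
  show "inj_on (perm_of A) (linords A)"
  proof (rule inj_onI)
    fix L M assume L: "L \<in> linords A" and M: "M \<in> linords A" and e: "perm_of A L = perm_of A M"
    have r: "rank L A x = rank M A x" if "x \<in> A" for x
      using perm_of_rank_pos[OF A that, of L] perm_of_rank_pos[OF A that, of M] e by simp
    have "(x, y) \<in> L \<longleftrightarrow> (x, y) \<in> M" for x y
    proof (cases "x \<in> A \<and> y \<in> A")
      case True
      then show ?thesis using rank_less_iff[OF L A, of x y] rank_less_iff[OF M A, of x y] r by simp
    next
      case False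
      then show ?thesis using linords_sub[OF L, of x y] linords_sub[OF M, of x y] by auto
    qed
    then show "L = M" by auto
  qed
  show "perm_of A ` linords A = {p. p permutes {1..card A}}"
  proof (intro equalityI subsetI)
    fix p assume "p \<in> {p. p permutes {1..card A}}"
    then have p: "p permutes {1..card A}" by simp
    define L where "L = {(x, y) \<in> A \<times> A. p (?c x) < p (?c y)}"
    have c: "bij_betw ?c A {1..card A}" by (rule rank_bij[OF pos_linords A])
    have pc: "bij_betw (p \<circ> ?c) A {1..card A}"
      by (rule bij_betw_trans[OF c permutes_imp_bij[OF p]])
    have L: "L \<in> linords A"
    proof (rule linordsI)
      fix x y assume "x \<in> A" "y \<in> A" "x \<noteq> y"
      then have "p (?c x) \<noteq> p (?c y)"
        using inj_onD[OF bij_betw_imp_inj_on[OF pc], of x y] by auto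
      then show "(x, y) \<in> L \<or> (y, x) \<in> L" using \<open>x \<in> A\<close> \<open>y \<in> A\<close> by (auto simp: L_def)
    qed (auto simp: L_def)
    have rk: "rank L A x = p (?c x)" if x: "x \<in> A" for x
    proof -
      have px: "p (?c x) \<in> {1..card A}" using bij_betwE[OF pc] x by auto
      \<comment> \<open>Since \<open>p \<circ> ?c\<close> is a bijection onto
        \<open>{1..card A}\<close>, exactly \<open>p (?c x)\<close> elements of \<open>A\<close>
        have a value of at most \<open>p (?c x)\<close>.\<close>
      have "{b \<in> A. (b, x) \<in> L \<or> b = x} = {b \<in> A. (p \<circ> ?c) b \<in> {1..p (?c x)}}"
      proof -
        have "p (?c b) \<in> {1..p (?c x)} \<longleftrightarrow> (b, x) \<in> L \<or> b = x" if b: "b \<in> A" for b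
        proof -
          have "p (?c b) = p (?c x) \<Longrightarrow> b = x"
            using inj_onD[OF bij_betw_imp_inj_on[OF pc], of b x] b x by auto
          moreover have "p (?c b) \<ge> 1" using bij_betwE[OF pc] b by auto
          ultimately show ?thesis using b x by (auto simp: L_def le_less)
        qed
        then show ?thesis by auto
      qed
      moreover have "bij_betw (p \<circ> ?c) {b \<in> A. (p \<circ> ?c) b \<in> {1..p (?c x)}} {1..p (?c x)}"
      proof (rule bij_betw_subset[OF pc])
        show "(p \<circ> ?c) ` {b \<in> A. (p \<circ> ?c) b \<in> {1..p (?c x)}} = {1..p (?c x)}"
        proof (intro equalityI subsetI)
          fix k assume k: "k \<in> {1..p (?c x)}"
          then have "k \<in> (p \<circ> ?c) ` A"
            using px bij_betw_imp_surj_on[OF pc] by simp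
          then obtain b where "b \<in> A" "k = (p \<circ> ?c) b" by (rule imageE)
          then show "k \<in> (p \<circ> ?c) ` {b \<in> A. (p \<circ> ?c) b \<in> {1..p (?c x)}}"
            using k by (intro image_eqI[of _ _ b]) simp_all
        qed auto
      qed auto
      ultimately have "card {b \<in> A. (b, x) \<in> L \<or> b = x} = card {1..p (?c x)}"
        by (simp only: bij_betw_same_card)
      then show ?thesis by (simp add: rank_def)
    qed
    have "perm_of A L = p"
    proof
      fix i show "perm_of A L i = p i"
      proof (cases "i \<in> {1..card A}")
        case True
        then obtain x where "x \<in> A" "i = ?c x" using bij_betw_imp_surj_on[OF c] by (metis imageE)
        then show ?thesis using perm_of_rank_pos[OF A] rk by simp
      next
        case False
        then show ?thesis using permutes_not_in[OF p False] by (auto simp: perm_of_def)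
      qed
    qed
    then show "p \<in> perm_of A ` linords A" using L by auto
  qed (use perm_of_permutes[OF _ A] in auto)
qed

text \<open>Exchanging the roles of \<open>pos A\<close> and \<open>L\<close> inverts the
  permutation, so the second exponent of \<open>wt\<close> is the number of inverse
  descents.\<close>

lemma wt_perm_of:
  assumes L: "L \<in> linords A" and A: "finite A"
  shows "wt A L = var_s ^ des (card A) (perm_of A L) * var_t ^ ides (card A) (perm_of A L)"
proof -
  let ?c = "rank (pos A) A" and ?p = "perm_of A L"
  have "desc (pos A) L = des (card A) ?p"
    unfolding desc_rank[OF pos_linords L A] des_def
    by (intro arg_cong[where f = card] Collect_cong) (auto simp: perm_of_def)
  moreover have "desc L (pos A) = ides (card A) ?p"
  proof -
    have "inv ?p i = ?c (inv_into A (rank L A) i)" if i: "i \<in> {1..card A}" for i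
    proof -
      let ?x = "inv_into A (rank L A) i"
      have "?x \<in> A" "rank L A ?x = i"
        using i rank_bij[OF L A] by (auto simp: bij_betw_def inv_into_into f_inv_into_f)
      then have "?p (?c ?x) = i" using perm_of_rank_pos[OF A] by simp
      then show ?thesis using permutes_inv_eq[OF perm_of_permutes[OF L A]] by simp
    qed
    then show ?thesis
      unfolding desc_rank[OF L pos_linords A] ides_def des_def
      by (intro arg_cong[where f = card] Collect_cong) auto
  qed
  ultimately show ?thesis by (simp add: wt_def)
qed

text \<open>A set \<open>I\<close> of positions has consecutive position ranks \<open>{i..j}\<close>
  exactly if it is an interval of \<open>pos A\<close>, and the permutation maps these ranks to the
  \<open>L\<close>-ranks of \<open>I\<close>. Hence proper blocks match the intervals that violate
  \<open>simple\<close>.\<close>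

lemma perm_of_Simp:
  assumes L: "L \<in> linords A" and A: "finite A"
  shows "perm_of A L \<in> Simp (card A) \<longleftrightarrow> simple A L"
proof -
  let ?c = "rank (pos A) A" and ?p = "perm_of A L" and ?n = "card A"
  have c: "bij_betw ?c A {1..?n}" by (rule rank_bij[OF pos_linords A])
  have pc: "?p ` ?c ` I = rank L A ` I" if "I \<subseteq> A" for I
    unfolding image_image using that perm_of_rank_pos[OF A] by (intro image_cong) auto
  have "(\<exists>i j. proper_block ?n ?p i j) \<longleftrightarrow> \<not> simple A L"
  proof
    assume "\<exists>i j. proper_block ?n ?p i j"
    then obtain i j a b where ij: "1 \<le> i" "i < j" "j \<le> ?n" "\<not> (i = 1 \<and> j = ?n)"
      and ab: "?p ` {i..j} = {a..b}"
      unfolding proper_block_def is_block_def by (metis le_neq_implies_less)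
    define I where "I = inv_into A ?c ` {i..j}"
    have sub: "{i..j} \<subseteq> ?c ` A" using ij c by (auto simp: bij_betw_def)
    have cI: "?c ` I = {i..j}" unfolding I_def by (rule image_inv_into_cancel[OF refl sub])
    have IA: "I \<subseteq> A"
      unfolding I_def by (intro image_subsetI inv_into_into) (use sub in auto)
    have ne: "I \<noteq> {}" using cI ij by auto
    have "interval (pos A) I"
      by (subst interval_iff_rank[OF pos_linords A IA ne], intro exI) (rule cI)
    moreover have "interval L I"
      by (subst interval_iff_rank[OF L A IA ne], intro exI)
        (simp only: pc[OF IA, symmetric] cI ab)
    moreover have "card I = card {i..j}"
      using card_image[OF inj_on_subset[OF bij_betw_imp_inj_on[OF c] IA]] cI by simp
    moreover have "I \<noteq> A"
      using cI bij_betw_imp_surj_on[OF c] ij by auto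
    ultimately have "interval (pos A) I \<and> interval L I" "\<not> (card I \<le> 1 \<or> I = A)"
      using ij by simp_all
    then show "\<not> simple A L" using IA unfolding simple_def by metis
  next
    assume "\<not> simple A L"
    then obtain I where IA: "I \<subseteq> A" and int: "interval (pos A) I" "interval L I"
      and I: "card I > 1" "I \<noteq> A"
      unfolding simple_def by (metis not_le)
    have ne: "I \<noteq> {}" using I by auto
    obtain i j where ij: "?c ` I = {i..j}" using interval_iff_rank[OF pos_linords A IA ne] int by blast
    obtain a b where ab: "rank L A ` I = {a..b}" using interval_iff_rank[OF L A IA ne] int by blast
    have ci: "card {i..j} = card I"
      using card_image[OF inj_on_subset[OF bij_betw_imp_inj_on[OF c] IA]] ij by simp
    then have lt: "i < j" using I by auto
    have sub: "{i..j} \<subseteq> {1..?n}"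
      using image_mono[OF IA, of ?c] by (simp only: ij bij_betw_imp_surj_on[OF c])
    have "\<not> (i = 1 \<and> j = ?n)"
    proof
      assume "i = 1 \<and> j = ?n"
      then have "card I = card A" using ci by simp
      then show False using card_subset_eq[OF A IA] I by simp
    qed
    moreover have "?p ` {i..j} = {a..b}" using pc[OF IA] by (simp only: ij ab)
    ultimately have "proper_block ?n ?p i j"
      using lt sub by (auto simp: proper_block_def is_block_def)
    then show "\<exists>i j. proper_block ?n ?p i j" by blast
  qed
  then show ?thesis
    using perm_of_permutes[OF L A] by (simp only: Simp_def mem_Collect_eq not_not simp_thms)
qed

lemma sum_wt_linords:
  assumes "finite A" "A \<noteq> {}"
  shows "(\<Sum>L\<in>linords A. wt A L) = F $ card A"
proof -
  have "(\<Sum>L\<in>linords A. wt A L)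
    = (\<Sum>L\<in>linords A. var_s ^ des (card A) (perm_of A L) * var_t ^ ides (card A) (perm_of A L))"
    by (rule sum.cong) (auto simp: wt_perm_of assms)
  also have "\<dots> = (\<Sum>p | p permutes {1..card A}. var_s ^ des (card A) p * var_t ^ ides (card A) p)"
    by (rule sum.reindex_bij_betw[OF perm_of_bij[OF assms(1)]])
  finally show ?thesis using assms by (simp add: F_def)
qed

lemma sum_wt_simple:
  assumes "finite A"
  shows "(\<Sum>L | L \<in> linords A \<and> simple A L. wt A L) = simp_poly (card A)"
proof -
  have bij: "bij_betw (perm_of A) {L. L \<in> linords A \<and> simple A L} (Simp (card A))"
  proof (rule bij_betw_subset[OF perm_of_bij[OF assms]])
    show "perm_of A ` {L. L \<in> linords A \<and> simple A L} = Simp (card A)"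
    proof (intro equalityI subsetI)
      fix p assume p: "p \<in> Simp (card A)"
      then have "p \<in> perm_of A ` linords A"
        using perm_of_bij[OF assms] by (auto simp: bij_betw_def Simp_def)
      then show "p \<in> perm_of A ` {L. L \<in> linords A \<and> simple A L}"
        using p perm_of_Simp[OF _ assms] by auto
    qed (use perm_of_Simp[OF _ assms] in auto)
  qed auto
  have "(\<Sum>L | L \<in> linords A \<and> simple A L. wt A L)
    = (\<Sum>L | L \<in> linords A \<and> simple A L.
        var_s ^ des (card A) (perm_of A L) * var_t ^ ides (card A) (perm_of A L))"
    by (rule sum.cong) (auto simp: wt_perm_of assms)
  also have "\<dots> = simp_poly (card A)"
    unfolding simp_poly_def by (rule sum.reindex_bij_betw[OF bij])
  finally show ?thesis .
qed

subsection \<open>Block partitions and composition of power series\<close>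

text \<open>A partition of \<open>{1..n}\<close> into intervals is given by the set \<open>R\<close> of the first elements of its
  parts, and \<open>first R x\<close> is the first element of the part of \<open>x\<close>.\<close>

definition first :: "nat set \<Rightarrow> nat \<Rightarrow> nat" where
  "first R x = Max {r \<in> R. r \<le> x}"

definition cuts :: "nat \<Rightarrow> nat set set" where
  "cuts n = {R. R \<subseteq> {1..n} \<and> (n > 0 \<longrightarrow> 1 \<in> R)}"

lemma cutsD: "R \<in> cuts n \<Longrightarrow> R \<subseteq> {1..n}" "R \<in> cuts n \<Longrightarrow> n > 0 \<Longrightarrow> 1 \<in> R"
  by (auto simp: cuts_def)

lemma finite_cuts: "finite (cuts n)"
  by (rule finite_subset[of _ "Pow {1..n}"]) (auto simp: cuts_def)

lemma cuts_finite: "R \<in> cuts n \<Longrightarrow> finite R"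
  by (rule finite_subset[OF cutsD(1)]) auto

lemma first_props:
  assumes R: "R \<in> cuts n" and x: "x \<in> {1..n}"
  shows "first R x \<in> R" "first R x \<le> x" "\<And>r. r \<in> R \<Longrightarrow> r \<le> x \<Longrightarrow> r \<le> first R x"
proof -
  have f: "finite {r \<in> R. r \<le> x}" by auto
  have "1 \<in> {r \<in> R. r \<le> x}" using cutsD(2)[OF R] x by auto
  then have "first R x \<in> {r \<in> R. r \<le> x}" unfolding first_def by (intro Max_in f) auto
  then show "first R x \<in> R" "first R x \<le> x" by auto
  show "\<And>r. r \<in> R \<Longrightarrow> r \<le> x \<Longrightarrow> r \<le> first R x"
    unfolding first_def by (rule Max_ge[OF f]) auto
qed

lemma first_eqI:
  assumes "r \<in> R" "r \<le> x" "\<And>q. q \<in> R \<Longrightarrow> q \<le> x \<Longrightarrow> q \<le> r"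
  shows "first R x = r"
  unfolding first_def by (rule Max_eqI) (use assms in auto)

lemma first_self: "r \<in> R \<Longrightarrow> first R r = r"
  by (rule first_eqI) auto

lemma first_mono:
  assumes R: "R \<in> cuts n" and x: "x \<in> {1..n}" "y \<in> {1..n}" "x \<le> y"
  shows "first R x \<le> first R y"
  using first_props(3)[OF R x(2) first_props(1)[OF R x(1)]] first_props(2)[OF R x(1)] x(3) by simp

lemma first_less_iff:
  assumes R: "R \<in> cuts n" and x: "x \<in> {1..n}" "y \<in> {1..n}" "first R x \<noteq> first R y"
  shows "x < y \<longleftrightarrow> first R x < first R y"
  using first_mono[OF R x(1,2)] first_mono[OF R x(2,1)] x(3) by linarith

lemma first_retraction:
  assumes R: "R \<in> cuts n"
  shows "retraction (first R) {1..n} R"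
proof
  show "first R ` {1..n} = R"
  proof (intro equalityI subsetI)
    fix r assume r: "r \<in> R"
    then show "r \<in> first R ` {1..n}"
      using cutsD(1)[OF R] first_self[OF r] by (intro image_eqI[of _ _ r]) auto
  qed (use first_props(1)[OF R] in auto)
qed (use cutsD(1)[OF R] first_self in auto)

lemma first_compat_pos:
  assumes R: "R \<in> cuts n"
  shows "compat (first R) {1..n} (pos {1..n})"
  unfolding compat_def
proof (intro ballI impI)
  fix x y assume "x \<in> {1..n}" "y \<in> {1..n}" "first R x \<noteq> first R y"
  moreover have "first R x \<in> {1..n}" "first R y \<in> {1..n}"
    using first_props(1)[OF R] cutsD(1)[OF R] calculation(1,2) by blast+
  ultimately show "(x, y) \<in> pos {1..n} \<longleftrightarrow> (first R x, first R y) \<in> pos {1..n}"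
    using first_less_iff[OF R] by simp
qed

lemma first_insert:
  assumes R: "R \<in> cuts j" and x: "x \<in> {1..n}"
  shows "first (insert (Suc j) R) x = (if x \<le> j then first R x else Suc j)"
proof (cases "x \<le> j")
  case True
  then have "{r \<in> insert (Suc j) R. r \<le> x} = {r \<in> R. r \<le> x}" by auto
  then show ?thesis using True by (simp add: first_def)
next
  case False
  have "first (insert (Suc j) R) x = Suc j"
    using cutsD(1)[OF R] False by (intro first_eqI) auto
  then show ?thesis using False by simp
qed

text \<open>Appending a last part to a partition of \<open>{1..j}\<close> leaves the earlier parts
  alone; this drives the induction on the number of parts.\<close>

lemma fib_insert:
  assumes R: "R \<in> cuts j" and j: "j < n"
  shows "fib (first (insert (Suc j) R)) {1..n} (Suc j) = {Suc j..n}"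
    and "r \<in> R \<Longrightarrow> fib (first (insert (Suc j) R)) {1..n} r = fib (first R) {1..j} r"
proof -
  have le: "first R x \<le> j" if "x \<in> {1..j}" for x
    using first_props(2)[OF R that] that by simp
  have "x \<in> fib (first (insert (Suc j) R)) {1..n} (Suc j) \<longleftrightarrow> x \<in> {Suc j..n}" for x
    using le[of x] first_insert[OF R, of x n] by (cases "x \<le> j") (auto simp: fib_def)
  then show "fib (first (insert (Suc j) R)) {1..n} (Suc j) = {Suc j..n}" by blast
  assume r: "r \<in> R"
  then have "r \<le> j" using cutsD(1)[OF R] by auto
  then have "x \<in> fib (first (insert (Suc j) R)) {1..n} r \<longleftrightarrow> x \<in> fib (first R) {1..j} r" for x
    using j first_insert[OF R, of x n] by (cases "x \<le> j") (auto simp: fib_def)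
  then show "fib (first (insert (Suc j) R)) {1..n} r = fib (first R) {1..j} r" by blast
qed

text \<open>The largest element of \<open>R\<close> is where the last part starts. Removing it
  leaves a partition of the \<open>j\<close> elements in front of that part.\<close>

lemma sum_cuts_Suc:
  "(\<Sum>R | R \<in> cuts n \<and> card R = Suc k. h R)
    = (\<Sum>j<n. \<Sum>R | R \<in> cuts j \<and> card R = k. h (insert (Suc j) R))"
proof -
  have notin: "Suc j \<notin> R" if "R \<in> cuts j" for j R
    using cutsD(1)[OF that] by auto
  have mx: "Max (insert (Suc j) R) = Suc j" if "R \<in> cuts j" for j R
    using cutsD(1)[OF that] cuts_finite[OF that] by (intro Max_eqI) auto
  have "(\<Sum>j<n. \<Sum>R | R \<in> cuts j \<and> card R = k. h (insert (Suc j) R))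
    = (\<Sum>(j, R)\<in>Sigma {..<n} (\<lambda>j. {R. R \<in> cuts j \<and> card R = k}). h (insert (Suc j) R))"
    by (rule sum.Sigma) (auto intro: finite_subset[OF _ finite_cuts])
  also have "\<dots> = (\<Sum>R | R \<in> cuts n \<and> card R = Suc k. h R)"
  proof (rule sum.reindex_bij_witness[where j = "\<lambda>(j, R). insert (Suc j) R"
        and i = "\<lambda>R. (Max R - 1, R - {Max R})"])
    fix a assume "a \<in> Sigma {..<n} (\<lambda>j. {R. R \<in> cuts j \<and> card R = k})"
    then obtain j R where a: "a = (j, R)" "j < n" "R \<in> cuts j" "card R = k" by auto
    then show "(Max (case a of (j, R) \<Rightarrow> insert (Suc j) R) - 1,
        (case a of (j, R) \<Rightarrow> insert (Suc j) R) - {Max (case a of (j, R) \<Rightarrow> insert (Suc j) R)}) = a"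
      using mx notin by simp
    have "insert (Suc j) R \<in> cuts n"
      using a cutsD[OF a(3)] by (cases "j = 0") (auto simp: cuts_def)
    then show "(case a of (j, R) \<Rightarrow> insert (Suc j) R) \<in> {R \<in> cuts n. card R = Suc k}"
      using a notin cuts_finite by simp
    show "h (case a of (j, R) \<Rightarrow> insert (Suc j) R) = (case a of (j, R) \<Rightarrow> h (insert (Suc j) R))"
      using a by simp
  next
    fix R assume "R \<in> {R \<in> cuts n. card R = Suc k}"
    then have R: "R \<in> cuts n" "card R = Suc k" by auto
    have fin: "finite R" by (rule cuts_finite[OF R(1)])
    have ne: "R \<noteq> {}" using R(2) by auto
    have m: "Max R \<in> R" by (rule Max_in[OF fin ne])
    then have m1: "Max R \<ge> 1" "Max R \<le> n" using cutsD(1)[OF R(1)] by auto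
    have le: "r \<le> Max R" if "r \<in> R" for r using Max_ge[OF fin that] .
    show "(case (Max R - 1, R - {Max R}) of (j, R) \<Rightarrow> insert (Suc j) R) = R"
      using m m1 by auto
    have "r \<in> {1..Max R - 1}" if "r \<in> R - {Max R}" for r
      using le[of r] that cutsD(1)[OF R(1)] by fastforce
    moreover have "1 \<in> R - {Max R}" if "Max R - 1 > 0"
      using that cutsD(2)[OF R(1)] m1 by auto
    ultimately have "R - {Max R} \<in> cuts (Max R - 1)" unfolding cuts_def by blast
    then show "(Max R - 1, R - {Max R}) \<in> Sigma {..<n} (\<lambda>j. {R. R \<in> cuts j \<and> card R = k})"
      using m m1 R(2) fin by auto
  qed
  finally show ?thesis ..
qed

text \<open>The coefficient of a \<open>k\<close>-th power is a sum over the compositions of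
  \<open>n\<close> into \<open>k\<close> positive parts, here encoded as partitions into intervals.
  The induction splits off the last part.\<close>

lemma fps_power_cuts:
  fixes f :: "'a :: comm_ring_1 fps"
  assumes f: "f $ 0 = 0"
  shows "f ^ k $ n
    = (\<Sum>R | R \<in> cuts n \<and> card R = k. \<Prod>r\<in>R. f $ card (fib (first R) {1..n} r))"
proof (induction k arbitrary: n)
  case 0
  \<comment> \<open>For positive \<open>n\<close> every member of \<open>cuts n\<close> contains 1,
    so the empty partition occurs only for \<open>n = 0\<close>.\<close>
  have "R \<in> cuts n \<and> card R = 0 \<longleftrightarrow> n = 0 \<and> R = {}" for R
    using cuts_finite[of R n] by (auto simp: cuts_def)
  then have "{R. R \<in> cuts n \<and> card R = 0} = (if n = 0 then {{}} else {})" by auto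
  then show ?case by simp
next
  case (Suc k)
  let ?b = "\<lambda>n R r. f $ card (fib (first R) {1..n} r)"
  have "f ^ Suc k $ n = (\<Sum>j=0..n. f ^ k $ j * f $ (n - j))"
    by (simp add: power_Suc2 fps_mult_nth del: power_Suc)
  \<comment> \<open>The term \<open>j = n\<close> stands for an empty last part and vanishes because
    \<open>f $ 0 = 0\<close>.\<close>
  also have "\<dots> = (\<Sum>j<n. f ^ k $ j * f $ (n - j))"
    by (rule sum.mono_neutral_right) (auto simp: f not_less)
  also have "\<dots> = (\<Sum>j<n. \<Sum>R | R \<in> cuts j \<and> card R = k.
      \<Prod>r\<in>insert (Suc j) R. ?b n (insert (Suc j) R) r)"
    unfolding Suc.IH sum_distrib_right
  proof (intro sum.cong refl)
    fix j R assume j: "j \<in> {..<n}" and "R \<in> {R \<in> cuts j. card R = k}"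
    then have R: "R \<in> cuts j" and jn: "j < n" by auto
    have "Suc j \<notin> R" using cutsD(1)[OF R] by auto
    then have "(\<Prod>r\<in>insert (Suc j) R. ?b n (insert (Suc j) R) r)
      = f $ card {Suc j..n} * (\<Prod>r\<in>R. ?b n (insert (Suc j) R) r)"
      using cuts_finite[OF R] fib_insert(1)[OF R jn] by simp
    also have "(\<Prod>r\<in>R. ?b n (insert (Suc j) R) r) = (\<Prod>r\<in>R. ?b j R r)"
      using fib_insert(2)[OF R jn] by (intro prod.cong) simp_all
    finally show "(\<Prod>r\<in>R. ?b j R r) * f $ (n - j)
      = (\<Prod>r\<in>insert (Suc j) R. ?b n (insert (Suc j) R) r)" by (simp add: mult.commute)
  qed
  also have "\<dots> = (\<Sum>R | R \<in> cuts n \<and> card R = Suc k. \<Prod>r\<in>R. ?b n R r)"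
    by (rule sum_cuts_Suc[symmetric])
  finally show ?case .
qed

lemma wt_decompose:
  assumes R: "R \<in> cuts n" and L: "L \<in> linords {1..n}" and c: "compat (first R) {1..n} L"
  shows "wt {1..n} L = wt R (rst L R)
    * (\<Prod>r\<in>R. wt (fib (first R) {1..n} r) (rst L (fib (first R) {1..n} r)))"
proof -
  interpret retraction "first R" "{1..n}" R by (rule first_retraction[OF R])
  note cp = first_compat_pos[OF R]
  show ?thesis
    unfolding wt_def desc_decompose[OF L c cp] desc_decompose[OF pos_linords cp c]
      rst_pos[OF fib_sub] rst_pos[OF BA]
    by (simp add: power_add power_sum prod.distrib)
qed

text \<open>For fixed \<open>R\<close>, the quotient counted by \<open>g\<close> and the block
  orders counted by the factors \<open>F\<close> glue to an order \<open>L\<close> compatible with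
  \<open>R\<close>. Exchanging the two summations collects all partitions belonging to one
  \<open>L\<close>.\<close>

lemma compose_F_nth:
  assumes n: "n > 0"
    and g: "\<And>R. finite R \<Longrightarrow> R \<noteq> {} \<Longrightarrow> g $ card R = (\<Sum>M\<in>linords R. \<mu> R M * wt R M)"
  shows "(g oo F) $ n = (\<Sum>L\<in>linords {1..n}.
    (\<Sum>R | R \<in> cuts n \<and> compat (first R) {1..n} L. \<mu> R (rst L R)) * wt {1..n} L)"
proof -
  let ?fib = "\<lambda>R. fib (first R) {1..n}"
  have blocks: "g $ card R * (\<Prod>r\<in>R. F $ card (?fib R r))
    = (\<Sum>L | L \<in> linords {1..n} \<and> compat (first R) {1..n} L. \<mu> R (rst L R) * wt {1..n} L)"
    if R: "R \<in> cuts n" for R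
  proof -
    interpret retraction "first R" "{1..n}" R by (rule first_retraction[OF R])
    have "R \<noteq> {}" using cutsD(2)[OF R n] by auto
    then have "g $ card R = (\<Sum>M\<in>linords R. \<mu> R M * wt R M)" by (rule g[OF finB])
    moreover have "(\<Prod>r\<in>R. F $ card (?fib R r)) = (\<Prod>r\<in>R. \<Sum>N\<in>linords (?fib R r). wt (?fib R r) N)"
    proof (rule prod.cong[OF refl])
      fix r assume "r \<in> R"
      then have "?fib R r \<noteq> {}" using in_fib_self by auto
      then show "F $ card (?fib R r) = (\<Sum>N\<in>linords (?fib R r). wt (?fib R r) N)"
        using sum_wt_linords[of "?fib R r"] finite_subset[OF fib_sub fin] by simp
    qed
    ultimately have "g $ card R * (\<Prod>r\<in>R. F $ card (?fib R r))
      = (\<Sum>L | L \<in> linords {1..n} \<and> compat (first R) {1..n} L.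
          \<mu> R (rst L R) * wt R (rst L R) * (\<Prod>r\<in>R. wt (?fib R r) (rst L (?fib R r))))"
      by (simp only: sum_compat[where f = "\<lambda>M. \<mu> R M * wt R M" and g = "\<lambda>r. wt (?fib R r)"])
    also have "\<dots> = (\<Sum>L | L \<in> linords {1..n} \<and> compat (first R) {1..n} L. \<mu> R (rst L R) * wt {1..n} L)"
      using wt_decompose[OF R] by (intro sum.cong) (auto simp: mult.assoc)
    finally show ?thesis .
  qed
  have "(g oo F) $ n = (\<Sum>k=0..n. \<Sum>R | R \<in> cuts n \<and> card R = k. g $ card R * (\<Prod>r\<in>R. F $ card (?fib R r)))"
    unfolding fps_compose_nth fps_power_cuts[OF F_nth_0] sum_distrib_left
    by (intro sum.cong) auto
  also have "\<dots> = (\<Sum>R\<in>cuts n. g $ card R * (\<Prod>r\<in>R. F $ card (?fib R r)))"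
  proof (rule sum.group[OF finite_cuts])
    show "card ` cuts n \<subseteq> {0..n}"
    proof (intro image_subsetI)
      fix R assume "R \<in> cuts n"
      then have "card R \<le> card {1..n}" by (intro card_mono cutsD(1)) auto
      then show "card R \<in> {0..n}" by simp
    qed
  qed simp
  also have "\<dots> = (\<Sum>R\<in>cuts n. \<Sum>L | L \<in> linords {1..n} \<and> compat (first R) {1..n} L. \<mu> R (rst L R) * wt {1..n} L)"
    by (rule sum.cong[OF refl blocks])
  also have "\<dots> = (\<Sum>L\<in>linords {1..n}. \<Sum>R | R \<in> cuts n \<and> compat (first R) {1..n} L. \<mu> R (rst L R) * wt {1..n} L)"
    by (rule sum.swap_restrict[OF finite_cuts finite_linords]) simp
  finally show ?thesis by (simp only: sum_distrib_right)
qed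

subsection \<open>Quotients of a fixed order\<close>

lemma interval_converse: "interval (L\<inverse>) I \<longleftrightarrow> interval L I"
  unfolding interval_def by auto

lemma interval_side:
  assumes M: "M \<in> linords A" and I: "interval M I" "I \<subseteq> A" and ab: "a \<in> I" "b \<in> I"
    and c: "c \<in> A" "c \<notin> I" and r: "(a, c) \<in> M"
  shows "(b, c) \<in> M"
proof (rule ccontr)
  assume "(b, c) \<notin> M"
  moreover have "b \<in> A" "b \<noteq> c" using I ab c by auto
  ultimately have "(c, b) \<in> M" using linords_total[OF M, of b c] c by auto
  then show False using intervalD[OF I(1) ab r] c by auto
qed

text \<open>Allows \<open>merge_compat\<close> to replace one representative inside a merged
  interval by another without affecting comparisons with the outside.\<close>

lemma interval_side_iff:
  assumes "M \<in> linords A" "interval M I" "I \<subseteq> A" "a \<in> I" "b \<in> I" "c \<in> A" "c \<notin> I"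
  shows "(a, c) \<in> M \<longleftrightarrow> (b, c) \<in> M" and "(c, a) \<in> M \<longleftrightarrow> (c, b) \<in> M"
proof -
  show "(a, c) \<in> M \<longleftrightarrow> (b, c) \<in> M"
    using interval_side[OF assms(1-7)] interval_side[OF assms(1-3,5,4,6,7)] by blast
  have i: "interval (M\<inverse>) I" using assms(2) by (simp add: interval_converse)
  show "(c, a) \<in> M \<longleftrightarrow> (c, b) \<in> M"
    using interval_side[OF linords_converse[OF assms(1)] i assms(3-7)]
      interval_side[OF linords_converse[OF assms(1)] i assms(3,5,4,6,7)] by auto
qed

context retraction
begin

lemma interval_fib:
  assumes M: "M \<in> linords A" and c: "compat \<rho> A M"
  shows "interval M (fib \<rho> A r)"
proof (rule intervalI)
  fix x y z assume x: "x \<in> fib \<rho> A r" "y \<in> fib \<rho> A r" and z: "(x, z) \<in> M" "(z, y) \<in> M"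
  have mem: "x \<in> A" "y \<in> A" "z \<in> A" "\<rho> x = r" "\<rho> y = r"
    using x linords_sub[OF M z(1)] by (auto simp: fib_def)
  have "\<rho> z = r"
  proof (rule ccontr)
    assume "\<rho> z \<noteq> r"
    then have "(r, \<rho> z) \<in> M" "(\<rho> z, r) \<in> M"
      using compatD[OF c mem(1,3)] compatD[OF c mem(3,2)] mem z by auto
    then show False using linords_asym[OF M] by auto
  qed
  then show "z \<in> fib \<rho> A r" using mem by (simp add: fib_def)
qed

text \<open>A representative strictly between \<open>\<rho> x\<close> and \<open>\<rho> y\<close> is
  itself an element of \<open>A\<close> strictly between \<open>x\<close> and \<open>y\<close>,
  hence belongs to \<open>I\<close>.\<close>

lemma interval_image:
  assumes M: "M \<in> linords A" and c: "compat \<rho> A M" and I: "interval M I" "I \<subseteq> A"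
  shows "interval (rst M B) (\<rho> ` I)"
proof (rule intervalI)
  fix a b z assume "a \<in> \<rho> ` I" "b \<in> \<rho> ` I" and z: "(a, z) \<in> rst M B" "(z, b) \<in> rst M B"
  then obtain x y where x: "x \<in> I" "a = \<rho> x" and y: "y \<in> I" "b = \<rho> y" by auto
  have zB: "z \<in> B" and r: "(\<rho> x, z) \<in> M" "(z, \<rho> y) \<in> M" using z x y by auto
  have zA: "z \<in> A" "\<rho> z = z" using zB BA idem by auto
  have mem: "x \<in> A" "y \<in> A" using x y I by auto
  have "\<rho> x \<noteq> z" "z \<noteq> \<rho> y" using r linords_irrefl[OF M] by auto
  then have "(x, z) \<in> M" "(z, y) \<in> M"
    using compatD[OF c mem(1) zA(1)] compatD[OF c zA(1) mem(2)] r zA(2) by auto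
  then have "z \<in> I" by (rule intervalD[OF I(1) x(1) y(1)])
  then show "z \<in> \<rho> ` I" using zA(2) by (metis imageI)
qed

text \<open>As \<open>I\<close> meets every block, the end points \<open>a\<close> and
  \<open>b\<close> come from elements of \<open>I\<close>. If \<open>\<rho> z\<close> were between
  them, \<open>z\<close> would be between those elements and so in \<open>I\<close>.\<close>

lemma interval_delete_block:
  assumes c: "compat \<rho> A M" and I: "interval M I" "I \<subseteq> A" "\<rho> ` I = B"
    and z: "z \<in> A" "z \<notin> I"
  shows "interval (rst M B) (B - {\<rho> z})"
proof (rule intervalI)
  fix a b w assume ab: "a \<in> B - {\<rho> z}" "b \<in> B - {\<rho> z}"
    and w: "(a, w) \<in> rst M B" "(w, b) \<in> rst M B"
  have "a \<in> \<rho> ` I" "b \<in> \<rho> ` I" using ab I(3) by auto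
  then obtain x y where x: "x \<in> I" "a = \<rho> x" and y: "y \<in> I" "b = \<rho> y" by auto
  have mem: "x \<in> A" "y \<in> A" using x y I by auto
  have "w \<noteq> \<rho> z"
  proof
    assume "w = \<rho> z"
    then have "(x, z) \<in> M" "(z, y) \<in> M"
      using compatD[OF c mem(1) z(1)] compatD[OF c z(1) mem(2)] w ab x y by auto
    then show False using intervalD[OF I(1) x(1) y(1)] z(2) by auto
  qed
  then show "w \<in> B - {\<rho> z}" using w by simp
qed

end

section \<open>Increasing and decreasing quotients\<close>

text \<open>The positions at which the underlying permutation splits as a direct sum; those of
  \<open>L\<inverse>\<close> are the positions at which it splits as a skew sum.\<close>

definition cutpts :: "nat \<Rightarrow> nat rel \<Rightarrow> nat set" where
  "cutpts n L = {c \<in> {2..n}. \<forall>x\<in>{1..n}. \<forall>y\<in>{1..n}. x < c \<longrightarrow> c \<le> y \<longrightarrow> (x, y) \<in> L}"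

lemma cutptsD:
  "c \<in> cutpts n L \<Longrightarrow> x \<in> {1..n} \<Longrightarrow> y \<in> {1..n} \<Longrightarrow> x < c \<Longrightarrow> c \<le> y \<Longrightarrow> (x, y) \<in> L"
  by (simp add: cutpts_def)

lemma cutpts_range: "c \<in> cutpts n L \<Longrightarrow> c \<in> {2..n}"
  by (simp add: cutpts_def)

lemma cutpts_intervals:
  assumes L: "L \<in> linords {1..n}" and c: "c \<in> cutpts n L"
  shows "interval L {1..<c}" "interval L {c..n}"
proof -
  note cn = cutpts_range[OF c]
  show "interval L {1..<c}"
  proof (rule intervalI)
    fix x y z assume x: "x \<in> {1..<c}" "y \<in> {1..<c}" and r: "(x, z) \<in> L" "(z, y) \<in> L"
    have z: "z \<in> {1..n}" using linords_sub[OF L r(1)] by simp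
    have "\<not> c \<le> z"
    proof
      assume "c \<le> z"
      then have "(y, z) \<in> L" using cutptsD[OF c _ z, of y] x cn by auto
      then show False using linords_asym[OF L] r by auto
    qed
    then show "z \<in> {1..<c}" using z by auto
  qed
  show "interval L {c..n}"
  proof (rule intervalI)
    fix x y z assume x: "x \<in> {c..n}" "y \<in> {c..n}" and r: "(x, z) \<in> L" "(z, y) \<in> L"
    have z: "z \<in> {1..n}" using linords_sub[OF L r(1)] by simp
    have "\<not> z < c"
    proof
      assume "z < c"
      then have "(z, x) \<in> L" using cutptsD[OF c z, of x] x cn by auto
      then show False using linords_asym[OF L] r by auto
    qed
    then show "z \<in> {c..n}" using z by auto
  qed
qed

lemma compat_converse: "compat \<rho> A (L\<inverse>) \<longleftrightarrow> compat \<rho> A L"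
  unfolding compat_def by (auto simp: eq_commute)

text \<open>In an increasing quotient every block start other than 1 separates smaller positions
  with smaller values from the rest. Conversely, cutting only at such points leaves blocks that
  increase from left to right.\<close>

lemma compat_increasing_iff:
  assumes L: "L \<in> linords {1..n}" and R: "R \<in> cuts n"
  shows "compat (first R) {1..n} L \<and> rst L R = pos R \<longleftrightarrow> R \<subseteq> insert 1 (cutpts n L)"
proof
  assume h: "compat (first R) {1..n} L \<and> rst L R = pos R"
  show "R \<subseteq> insert 1 (cutpts n L)"
  proof
    fix c assume c: "c \<in> R"
    have "c \<in> cutpts n L" if ne: "c \<noteq> 1"
      unfolding cutpts_def
    proof (intro CollectI conjI ballI impI)
      show "c \<in> {2..n}" using ne c cutsD(1)[OF R] by force
      fix x y assume xy: "x \<in> {1..n}" "y \<in> {1..n}" "x < c" "c \<le> y"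
      have lt: "first R x < first R y"
        using first_props(2)[OF R xy(1)] first_props(3)[OF R xy(2) c xy(4)] xy(3) by linarith
      have "(first R x, first R y) \<in> pos R"
        using lt first_props(1)[OF R xy(1)] first_props(1)[OF R xy(2)] by simp
      then have "(first R x, first R y) \<in> rst L R" using h by (simp only: h)
      then have "(first R x, first R y) \<in> L" unfolding in_rst by simp
      then show "(x, y) \<in> L" using compatD[of "first R" "{1..n}" L x y] h xy lt by auto
    qed
    then show "c \<in> insert 1 (cutpts n L)" by auto
  qed
next
  assume sub: "R \<subseteq> insert 1 (cutpts n L)"
  have up: "(x, y) \<in> L" if xy: "x \<in> {1..n}" "y \<in> {1..n}" "first R x < first R y" for x y
  proof -
    have c: "first R y \<in> R" "first R y \<le> y" using first_props[OF R xy(2)] by auto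
    have "first R x \<in> R" by (rule first_props(1)[OF R xy(1)])
    then have "first R x \<ge> 1" using cutsD(1)[OF R] by auto
    then have "first R y \<in> cutpts n L" using sub c xy by auto
    moreover have "x < first R y"
      using first_props(3)[OF R xy(1) c(1)] xy(3) by linarith
    ultimately show ?thesis using cutptsD xy c by blast
  qed
  have iff: "(x, y) \<in> L \<longleftrightarrow> first R x < first R y"
    if "x \<in> {1..n}" "y \<in> {1..n}" "first R x \<noteq> first R y" for x y
    using up[of x y] up[of y x] linords_asym[OF L, of x y] that by (metis linorder_neqE_nat)
  have R1: "x \<in> {1..n}" "first R x = x" if "x \<in> R" for x
    using that cutsD(1)[OF R] first_self by auto
  have "compat (first R) {1..n} L"
    unfolding compat_def
  proof (intro ballI impI)
    fix x y assume xy: "x \<in> {1..n}" "y \<in> {1..n}" "first R x \<noteq> first R y"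
    have "first R x \<in> R" "first R y \<in> R" using first_props(1)[OF R] xy by auto
    then show "(x, y) \<in> L \<longleftrightarrow> (first R x, first R y) \<in> L"
      using iff[OF xy] iff[of "first R x" "first R y"] R1 xy(3) by simp
  qed
  moreover have "(x, y) \<in> rst L R \<longleftrightarrow> (x, y) \<in> pos R" for x y
    using iff[of x y] R1[of x] R1[of y] linords_irrefl[OF L, of x] by (cases "x = y") auto
  then have "rst L R = pos R" by (intro set_eqI) (simp only: split_paired_all)
  ultimately show "compat (first R) {1..n} L \<and> rst L R = pos R" by blast
qed

text \<open>This expands the product of \<open>1 - 1\<close> over \<open>A\<close>.\<close>

lemma sum_alternating_Pow:
  assumes "finite A"
  shows "(\<Sum>X\<in>Pow A. (- 1) ^ card X) = (if A = {} then 1 else (0 :: 'a :: comm_ring_1))"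
  using prod_diff_conv_sum[OF assms, of "\<lambda>_. 1" "\<lambda>_. 1 :: 'a"] assms by (simp add: power_0_left)

text \<open>The admissible \<open>R\<close> arise by adding 1 to an arbitrary subset of
  \<open>cutpts n L\<close>. Thus \<open>card R - 1\<close> is the size of that subset, and the
  alternating sum cancels unless there are no cut points.\<close>

lemma sum_increasing_quotients:
  assumes L: "L \<in> linords {1..n}" and n: "n > 0"
  shows "(\<Sum>R | R \<in> cuts n \<and> compat (first R) {1..n} L \<and> rst L R = pos R. (- 1) ^ (card R - 1))
    = (if cutpts n L = {} then 1 else (0 :: 'a :: comm_ring_1))"
proof -
  have fin: "finite (cutpts n L)" by (simp add: cutpts_def)
  have not1: "1 \<notin> S" if "S \<subseteq> cutpts n L" for S
    using that cutpts_range[of 1 n L] by auto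
  have "R \<in> cuts n \<and> compat (first R) {1..n} L \<and> rst L R = pos R
      \<longleftrightarrow> R \<in> insert 1 ` Pow (cutpts n L)" for R
  proof
    assume h: "R \<in> cuts n \<and> compat (first R) {1..n} L \<and> rst L R = pos R"
    then have "R \<subseteq> insert 1 (cutpts n L)" using compat_increasing_iff[OF L, of R] by blast
    moreover have "1 \<in> R" using h cutsD(2) n by blast
    ultimately have "R - {1} \<in> Pow (cutpts n L)" "R = insert 1 (R - {1})" by auto
    then show "R \<in> insert 1 ` Pow (cutpts n L)" by (rule rev_image_eqI)
  next
    assume "R \<in> insert 1 ` Pow (cutpts n L)"
    then obtain S where S: "S \<subseteq> cutpts n L" "R = insert 1 S" by auto
    have "S \<subseteq> {1..n}" using S(1) by (auto simp: cutpts_def)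
    then have R: "R \<in> cuts n" using S(2) n by (simp add: cuts_def)
    moreover have "R \<subseteq> insert 1 (cutpts n L)" using S by auto
    ultimately show "R \<in> cuts n \<and> compat (first R) {1..n} L \<and> rst L R = pos R"
      using compat_increasing_iff[OF L R] by blast
  qed
  then have "(\<Sum>R | R \<in> cuts n \<and> compat (first R) {1..n} L \<and> rst L R = pos R. (- 1) ^ (card R - 1))
    = (\<Sum>R\<in>insert 1 ` Pow (cutpts n L). (- 1 :: 'a) ^ (card R - 1))"
    by (intro sum.cong) auto
  also have "\<dots> = (\<Sum>S\<in>Pow (cutpts n L). (- 1) ^ card S)"
  proof (rule sum.reindex_cong[of "insert 1"])
    show "inj_on (insert 1) (Pow (cutpts n L))"
      by (rule inj_onI) (use not1 in \<open>auto simp: insert_ident\<close>)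
    fix S assume "S \<in> Pow (cutpts n L)"
    then have "S \<subseteq> cutpts n L" by simp
    then show "(- 1 :: 'a) ^ (card (insert 1 S) - 1) = (- 1) ^ card S"
      using not1[of S] finite_subset[OF _ fin, of S] by simp
  qed simp
  finally show ?thesis using sum_alternating_Pow[OF fin] by metis
qed

lemma sum_decreasing_quotients:
  assumes L: "L \<in> linords {1..n}" and n: "n > 0"
  shows "(\<Sum>R | R \<in> cuts n \<and> compat (first R) {1..n} L \<and> rst L R = (pos R)\<inverse>. (- 1) ^ (card R - 1))
    = (if cutpts n (L\<inverse>) = {} then 1 else (0 :: 'a :: comm_ring_1))"
proof -
  have "rst (L\<inverse>) R = (rst L R)\<inverse>" for R by auto
  then have "rst (L\<inverse>) R = pos R \<longleftrightarrow> rst L R = (pos R)\<inverse>" for R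
    using converse_converse by metis
  then show ?thesis
    using sum_increasing_quotients[OF linords_converse[OF L] n] by (simp add: compat_converse)
qed

section \<open>Existence and uniqueness of the simple quotient\<close>

text \<open>An interval \<open>I\<close> maps onto an interval of the simple quotient. If it met every block but
  missed some \<open>z\<close>, then deleting the block of \<open>z\<close> would leave a proper interval of the quotient.\<close>

lemma proper_interval_in_block:
  assumes L: "L \<in> linords {1..n}" and R: "R \<in> cuts n" and c: "compat (first R) {1..n} L"
    and s: "simple R (rst L R)" "card R \<ge> 3"
    and I: "interval (pos {1..n}) I" "interval L I" "I \<subseteq> {1..n}" "I \<noteq> {1..n}"
    and xy: "x \<in> I" "y \<in> I"
  shows "first R x = first R y"
proof -
  interpret retraction "first R" "{1..n}" R by (rule first_retraction[OF R])
  note cp = first_compat_pos[OF R]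
  have sub: "first R ` I \<subseteq> R" using rho_in I(3) by auto
  have "interval (pos R) (first R ` I)" "interval (rst L R) (first R ` I)"
    using interval_image[OF pos_linords cp I(1,3)] interval_image[OF L c I(2,3)] rst_pos[OF BA]
    by simp_all
  then have "card (first R ` I) \<le> 1 \<or> first R ` I = R"
    using s(1) sub unfolding simple_def by blast
  moreover have "first R ` I \<noteq> R"
  proof
    assume im: "first R ` I = R"
    obtain z where z: "z \<in> {1..n}" "z \<notin> I" using I(3,4) by blast
    have "interval (pos R) (R - {first R z})" "interval (rst L R) (R - {first R z})"
      using interval_delete_block[OF cp I(1,3) im z] interval_delete_block[OF c I(2,3) im z]
        rst_pos[OF BA] by simp_all
    then have "card (R - {first R z}) \<le> 1 \<or> R - {first R z} = R"
      using s(1) unfolding simple_def by blast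
    moreover have "first R z \<in> R" using rho_in[OF z(1)] .
    \<comment> \<open>At least two blocks remain because \<open>card R \<ge> 3\<close>, and the
      deleted block does belong to \<open>R\<close>, so both alternatives fail.\<close>
    ultimately show False using s(2) finB by auto
  qed
  ultimately have "card (first R ` I) \<le> 1" by simp
  moreover have "finite (first R ` I)" by (rule finite_subset[OF sub finB])
  ultimately show ?thesis using xy by (metis card_le_Suc0_iff_eq One_nat_def imageI)
qed

text \<open>Each of the two intervals lies inside one block, which leaves at most two blocks.
  Stating this through intervals covers direct and skew sums alike.\<close>

lemma no_simple_quotient_if_two_intervals:
  assumes L: "L \<in> linords {1..n}" and R: "R \<in> cuts n" and c: "compat (first R) {1..n} L"
    and s: "simple R (rst L R)" "card R \<ge> 3" and int: "interval L {1..<d}" "interval L {d..n}"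
  shows "d \<notin> {2..n}"
proof
  assume d: "d \<in> {2..n}"
  note blk = proper_interval_in_block[OF L R c s]
  interpret retraction "first R" "{1..n}" R by (rule first_retraction[OF R])
  have p: "interval (pos {1..n}) {1..<d}" "interval (pos {1..n}) {d..n}"
    by (auto simp: interval_def)
  have ne: "{1..<d} \<subseteq> {1..n}" "{1..<d} \<noteq> {1..n}" "{d..n} \<subseteq> {1..n}" "{d..n} \<noteq> {1..n}"
  proof -
    have "1 \<notin> {d..n}" "1 \<in> {1..n}" "n \<notin> {1..<d}" "n \<in> {1..n}" using d by auto
    then show "{1..<d} \<noteq> {1..n}" "{d..n} \<noteq> {1..n}" by metis+
  qed (use d in auto)
  have "first R x \<in> {first R 1, first R d}" if x: "x \<in> {1..n}" for x
  proof (cases "x < d")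
    case True
    then have "first R x = first R 1" using blk[OF p(1) int(1) ne(1,2), of x 1] x d by auto
    then show ?thesis by simp
  next
    case False
    then have "first R x = first R d" using blk[OF p(2) int(2) ne(3,4), of x d] x d by auto
    then show ?thesis by simp
  qed
  then have "first R ` {1..n} \<subseteq> {first R 1, first R d}" by (rule image_subsetI)
  then have "R \<subseteq> {first R 1, first R d}" by (simp only: image)
  then have "card R \<le> card {first R 1, first R d}" by (intro card_mono) auto
  also have "\<dots> \<le> 2" by (simp add: card_insert_if)
  finally show False using s(2) by simp
qed

text \<open>Blocks of \<open>Q\<close> are proper intervals, so each lies inside a block of
  \<open>R\<close>. The start of a block of \<open>R\<close> must then also start a block of
  \<open>Q\<close>. Equality follows by exchanging \<open>R\<close> and \<open>Q\<close>.\<close>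

lemma simple_quotient_unique:
  assumes L: "L \<in> linords {1..n}"
    and R: "R \<in> cuts n" "compat (first R) {1..n} L" "simple R (rst L R)" "card R \<ge> 3"
    and Q: "Q \<in> cuts n" "compat (first Q) {1..n} L" "simple Q (rst L Q)" "card Q \<ge> 3"
  shows "R \<subseteq> Q"
proof
  have coarser: "first R x = first R y"
    if R: "R \<in> cuts n" "compat (first R) {1..n} L" "simple R (rst L R)" "card R \<ge> 3"
    and Q: "Q \<in> cuts n" "compat (first Q) {1..n} L" "card Q \<ge> 3"
    and xy: "x \<in> {1..n}" "y \<in> {1..n}" "first Q x = first Q y" for R Q x y
  proof -
    interpret Q: retraction "first Q" "{1..n}" Q by (rule first_retraction[OF Q(1)])
    let ?I = "fib (first Q) {1..n} (first Q x)"
    have "?I \<noteq> {1..n}"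
    proof
      assume e: "?I = {1..n}"
      have "first Q ` ?I \<subseteq> {first Q x}" by (auto simp: fib_def)
      then have "Q \<subseteq> {first Q x}" using Q.image e by simp
      then have "card Q \<le> card {first Q x}" by (intro card_mono) auto
      then show False using Q(3) by simp
    qed
    then show ?thesis
      using proper_interval_in_block[OF L R Q.interval_fib[OF pos_linords first_compat_pos[OF Q(1)]]
        Q.interval_fib[OF L Q(2)] Q.fib_sub, of "first Q x" x y] xy
      by (auto simp: fib_def)
  qed
  fix r assume r: "r \<in> R"
  then have r1: "r \<in> {1..n}" using cutsD(1)[OF R(1)] by auto
  have q: "first Q r \<in> Q" "first Q r \<le> r" using first_props[OF Q(1) r1] by auto
  have q1: "first Q r \<in> {1..n}" using q cutsD(1)[OF Q(1)] by auto
  have "first R (first Q r) = first R r"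
    using coarser[OF R Q(1,2,4) q1 r1] first_self[OF q(1)] by simp
  then have "r \<le> first Q r" using first_self[OF r] first_props(2)[OF R(1) q1] by simp
  then show "r \<in> Q" using q by simp
qed

text \<open>The blocks with starts in \<open>I\<close> are united. \<open>Min I\<close> survives
  because partitions are encoded by the first elements of their parts.\<close>

definition merge :: "nat set \<Rightarrow> nat set \<Rightarrow> nat set" where
  "merge R I = insert (Min I) (R - I)"

lemma first_merge:
  assumes R: "R \<in> cuts n" and I: "I \<subseteq> R" "I \<noteq> {}" "interval (pos R) I" and x: "x \<in> {1..n}"
  shows "first (merge R I) x = (if first R x \<in> I then Min I else first R x)"
proof -
  have fin: "finite I" by (rule finite_subset[OF I(1) cuts_finite[OF R]])
  have m: "Min I \<in> I" "\<And>q. q \<in> I \<Longrightarrow> Min I \<le> q" using fin I(2) by auto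
  note f = first_props[OF R x]
  show ?thesis
  proof (cases "first R x \<in> I")
    case True
    have "first (merge R I) x = Min I"
    proof (rule first_eqI)
      show "Min I \<in> merge R I" by (simp add: merge_def)
      show "Min I \<le> x" using m(2)[OF True] f(2) by simp
      fix q assume q: "q \<in> merge R I" "q \<le> x"
      show "q \<le> Min I"
      \<comment> \<open>A start \<open>q\<close> outside \<open>I\<close> but between
        \<open>Min I\<close> and \<open>first R x\<close> would contradict that \<open>I\<close> is
        an interval of \<open>pos R\<close>.\<close>
      proof (rule ccontr)
        assume lt: "\<not> q \<le> Min I"
        then have qR: "q \<in> R" "q \<notin> I" using q by (auto simp: merge_def)
        have "q \<le> first R x" by (rule f(3)[OF qR(1) q(2)])
        moreover have "q \<noteq> first R x" using True qR by auto
        ultimately have "(Min I, q) \<in> pos R" "(q, first R x) \<in> pos R"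
          using lt qR m(1) I(1) f(1) by auto
        then show False using intervalD[OF I(3) m(1) True] qR by auto
      qed
    qed
    then show ?thesis using True by simp
  next
    case False
    have "first (merge R I) x = first R x"
    proof (rule first_eqI)
      show "first R x \<in> merge R I" using False f(1) by (simp add: merge_def)
      show "first R x \<le> x" by (rule f(2))
      fix q assume q: "q \<in> merge R I" "q \<le> x"
      then have "q \<in> R" using m(1) I(1) by (auto simp: merge_def)
      then show "q \<le> first R x" using f(3) q by simp
    qed
    then show ?thesis using False by simp
  qed
qed

lemma merge_cuts:
  assumes R: "R \<in> cuts n" and I: "I \<subseteq> R" "I \<noteq> {}"
  shows "merge R I \<in> cuts n"
proof -
  have fin: "finite I" by (rule finite_subset[OF I(1) cuts_finite[OF R]])
  have m: "Min I \<in> I" using fin I(2) by auto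
  then have "merge R I \<subseteq> R" using I by (auto simp: merge_def)
  moreover have "1 \<in> merge R I" if n: "n > 0"
  proof (cases "1 \<in> I")
    case True
    have "Min I \<ge> 1" using m I(1) cutsD(1)[OF R] by auto
    then have "Min I = 1" using Min_le[OF fin True] by simp
    then show ?thesis by (simp add: merge_def)
  next
    case False
    then show ?thesis using cutsD(2)[OF R n] by (simp add: merge_def)
  qed
  ultimately show ?thesis using R unfolding cuts_def by blast
qed

text \<open>Comparisons are first moved to the quotient by \<open>R\<close>. There an element of
  \<open>I\<close> may be replaced by \<open>Min I\<close>, as all elements of \<open>I\<close> lie
  on the same side of any element outside.\<close>

lemma merge_compat:
  assumes L: "L \<in> linords {1..n}" and R: "R \<in> cuts n" and c: "compat (first R) {1..n} L"
    and I: "I \<subseteq> R" "I \<noteq> {}" "interval (pos R) I" "interval (rst L R) I"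
  shows "compat (first (merge R I)) {1..n} L"
  unfolding compat_def
proof (intro ballI impI)
  have fin: "finite I" by (rule finite_subset[OF I(1) cuts_finite[OF R]])
  have m: "Min I \<in> I" using fin I(2) by auto
  note fm = first_merge[OF R I(1-3)]
  have M: "rst L R \<in> linords R" by (rule rst_linords[OF L cutsD(1)[OF R]])
  note side = interval_side_iff[OF M I(4,1)]
  fix x y assume xy: "x \<in> {1..n}" "y \<in> {1..n}" "first (merge R I) x \<noteq> first (merge R I) y"
  note fx = first_props(1)[OF R xy(1)] and fy = first_props(1)[OF R xy(2)]
  have ne: "first R x \<noteq> first R y" using xy(3) unfolding fm[OF xy(1)] fm[OF xy(2)]
    by (rule contrapos_nn) simp
  have "(x, y) \<in> L \<longleftrightarrow> (first R x, first R y) \<in> rst L R"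
    using compatD[OF c xy(1,2) ne] fx fy by simp
  also have "\<dots> \<longleftrightarrow> (first (merge R I) x, first (merge R I) y) \<in> rst L R"
  proof (cases "first R x \<in> I"; cases "first R y \<in> I")
    assume "first R x \<in> I" "first R y \<in> I"
    then show ?thesis using xy(3) fm[OF xy(1)] fm[OF xy(2)] by simp
  next
    assume h: "first R x \<in> I" "first R y \<notin> I"
    then show ?thesis using side(1)[OF h(1) m fy h(2)] fm[OF xy(1)] fm[OF xy(2)] by simp
  next
    assume h: "first R x \<notin> I" "first R y \<in> I"
    then show ?thesis using side(2)[OF h(2) m fx h(1)] fm[OF xy(1)] fm[OF xy(2)] by simp
  next
    assume "first R x \<notin> I" "first R y \<notin> I"
    then show ?thesis using fm[OF xy(1)] fm[OF xy(2)] by simp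
  qed
  also have "\<dots> \<longleftrightarrow> (first (merge R I) x, first (merge R I) y) \<in> L"
    using fm[OF xy(1)] fm[OF xy(2)] fx fy m I(1) by auto
  finally show "(x, y) \<in> L \<longleftrightarrow> (first (merge R I) x, first (merge R I) y) \<in> L" .
qed

text \<open>Merging makes a partition strictly coarser without making it trivial, which contradicts
  a minimal choice in \<open>simple_quotient_exists\<close>.\<close>

lemma merge_card:
  assumes R: "finite R" and I: "I \<subseteq> R" "card I \<ge> 2" "I \<noteq> R"
  shows "card (merge R I) < card R" "card (merge R I) \<ge> 2"
proof -
  have fin: "finite I" by (rule finite_subset[OF I(1) R])
  have "I \<noteq> {}" using I by auto
  then have m: "Min I \<in> I" using fin by auto
  have "card (merge R I) = Suc (card (R - I))"
    using m R by (simp add: merge_def)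
  moreover have "card (R - I) = card R - card I" by (rule card_Diff_subset[OF fin I(1)])
  moreover have "card I < card R" by (rule psubset_card_mono[OF R]) (use I in auto)
  ultimately show "card (merge R I) < card R" "card (merge R I) \<ge> 2" using I(2) by auto
qed

lemma cutpts_of_two_blocks:
  assumes L: "L \<in> linords {1..n}" and R: "R \<in> cuts n" and c: "compat (first R) {1..n} L"
    and d: "R = {1, d}" "d \<noteq> 1" and r: "(1, d) \<in> L"
  shows "d \<in> cutpts n L"
proof -
  have dn: "d \<in> {2..n}" using cutsD(1)[OF R] d by auto
  have f: "first R x = (if x < d then 1 else d)" if x: "x \<in> {1..n}" for x
    using first_props(1,2)[OF R x] first_props(3)[OF R x, of d] d dn by (cases "x < d") auto
  show ?thesis
    unfolding cutpts_def
  proof (intro CollectI conjI ballI impI dn)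
    fix x y assume xy: "x \<in> {1..n}" "y \<in> {1..n}" "x < d" "d \<le> y"
    have "first R x = 1" "first R y = d" using f[OF xy(1)] f[OF xy(2)] xy(3,4) by simp_all
    then show "(x, y) \<in> L" using compatD[OF c xy(1,2)] d(2) r by simp
  qed
qed

text \<open>A coarsest quotient with at least two blocks is simple, since a proper interval of it
  could be merged into a single block.\<close>

lemma simple_quotient_exists:
  assumes L: "L \<in> linords {1..n}" and n: "n \<ge> 2"
    and C: "cutpts n L = {}" "cutpts n (L\<inverse>) = {}"
  obtains R where "R \<in> cuts n" "compat (first R) {1..n} L" "simple R (rst L R)" "card R \<ge> 3"
proof -
  let ?P = "\<lambda>R. R \<in> cuts n \<and> compat (first R) {1..n} L \<and> card R \<ge> 2"
  \<comment> \<open>The partition into singletons shows that there is a candidate to minimize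
    over.\<close>
  have "?P {1..n}"
  proof -
    have "compat (first {1..n}) {1..n} L"
      unfolding compat_def using first_self[of _ "{1..n}"] by simp
    then show ?thesis using n by (simp add: cuts_def)
  qed
  then obtain R where P: "?P R" and min: "\<And>Q. ?P Q \<Longrightarrow> card R \<le> card Q"
    using ex_has_least_nat[of ?P "{1..n}" card] by blast
  have R: "R \<in> cuts n" and c: "compat (first R) {1..n} L" using P by auto
  have s: "simple R (rst L R)"
  proof (rule ccontr)
    assume "\<not> simple R (rst L R)"
    then obtain I where I: "I \<subseteq> R" "interval (pos R) I" "interval (rst L R) I" "\<not> card I \<le> 1" "I \<noteq> R"
      unfolding simple_def by blast
    have ne: "I \<noteq> {}" and c2: "card I \<ge> 2" using I(4) by auto
    note mc = merge_card[OF cuts_finite[OF R] I(1) c2 I(5)]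
    have "?P (merge R I)"
      using merge_cuts[OF R I(1) ne] merge_compat[OF L R c I(1) ne I(2,3)] mc(2) by simp
    then have "card R \<le> card (merge R I)" by (rule min)
    then show False using mc(1) by simp
  qed
  \<comment> \<open>A quotient with two blocks is increasing or decreasing and would yield a cut
    point of \<open>L\<close> or of its converse.\<close>
  have "card R \<noteq> 2"
  proof
    assume "card R = 2"
    moreover have R1: "1 \<in> R" using cutsD(2)[OF R] n by simp
    ultimately have "card (R - {1}) = 1" using cuts_finite[OF R] by simp
    then obtain d where "R - {1} = {d}" by (rule card_1_singletonE)
    then have d: "R = {1, d}" "d \<noteq> 1" using R1 by auto
    have "d \<in> {1..n}" "1 \<in> {1..n}" using d cutsD(1)[OF R] by auto
    then have "(1, d) \<in> L \<or> (1, d) \<in> L\<inverse>" using linords_total[OF L, of 1 d] d(2) by auto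
    then show False
      using cutpts_of_two_blocks[OF L R c d]
        cutpts_of_two_blocks[OF linords_converse[OF L] R _ d] c C
      by (auto simp: compat_converse)
  qed
  then have "card R \<ge> 3" using P by simp
  with that R c s show ?thesis by blast
qed

lemma card_simple_quotients:
  assumes L: "L \<in> linords {1..n}"
  shows "card {R \<in> cuts n. compat (first R) {1..n} L \<and> card R \<ge> 3 \<and> simple R (rst L R)}
    = (if n \<ge> 2 \<and> cutpts n L = {} \<and> cutpts n (L\<inverse>) = {} then 1 else 0)" (is "card ?Q = _")
proof (cases "n \<ge> 2 \<and> cutpts n L = {} \<and> cutpts n (L\<inverse>) = {}")
  case True
  then obtain R where R: "R \<in> cuts n" "compat (first R) {1..n} L" "simple R (rst L R)" "card R \<ge> 3"
    using simple_quotient_exists[OF L] by blast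
  have "Q = R" if Q: "Q \<in> ?Q" for Q
  proof (rule subset_antisym)
    have Q': "Q \<in> cuts n" "compat (first Q) {1..n} L" "simple Q (rst L Q)" "card Q \<ge> 3"
      using Q by auto
    show "Q \<subseteq> R" by (rule simple_quotient_unique[OF L Q' R])
    show "R \<subseteq> Q" by (rule simple_quotient_unique[OF L R Q'])
  qed
  moreover have "R \<in> ?Q" using R by simp
  ultimately have "?Q = {R}" by blast
  then show ?thesis using True by simp
next
  case False
  have "R \<notin> ?Q" for R
  proof
    assume "R \<in> ?Q"
    then have R: "R \<in> cuts n" "compat (first R) {1..n} L" "simple R (rst L R)" "card R \<ge> 3" by auto
    have "card R \<le> card {1..n}" by (rule card_mono[OF _ cutsD(1)[OF R(1)]]) simp
    then have "n \<ge> 2" using R(4) by simp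
    with False consider d where "d \<in> cutpts n L" | d where "d \<in> cutpts n (L\<inverse>)" by blast
    then show False
    proof cases
      case (1 d)
      then show ?thesis
        using no_simple_quotient_if_two_intervals[OF L R cutpts_intervals[OF L 1]] cutpts_range by blast
    next
      case (2 d)
      have "interval L {1..<d}" "interval L {d..n}"
        using cutpts_intervals[OF linords_converse[OF L] 2] by (simp_all add: interval_converse)
      then show ?thesis
        using no_simple_quotient_if_two_intervals[OF L R] cutpts_range[OF 2] by blast
    qed
  qed
  then have "?Q = {}" by blast
  then show ?thesis using False by (metis card.empty)
qed

text \<open>Separate summands instead of cases let each kind of quotient be summed on its own. On a
  single point the first two both give 1, and the third corrects the total to 1.\<close>

definition mu :: "nat set \<Rightarrow> nat rel \<Rightarrow> ratfun" where
  "mu R M = (if M = pos R then (- 1) ^ (card R - 1) else 0)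
    + (if M = (pos R)\<inverse> then (- 1) ^ (card R - 1) else 0)
    - (if card R = 1 then 1 else 0)
    - (if card R \<ge> 3 \<and> simple R M then 1 else 0)"

lemma sum_mu_quotients:
  assumes L: "L \<in> linords {1..n}" and n: "n > 0"
  shows "(\<Sum>R | R \<in> cuts n \<and> compat (first R) {1..n} L. mu R (rst L R)) = (if n = 1 then 1 else 0)"
proof -
  let ?X = "{R \<in> cuts n. compat (first R) {1..n} L}"
  have fin: "finite ?X" using finite_cuts by (rule rev_finite_subset) auto
  have fil: "(\<Sum>R\<in>?X. if Q R then f R else 0)
      = (\<Sum>R | R \<in> cuts n \<and> compat (first R) {1..n} L \<and> Q R. f R)"
    for Q and f :: "nat set \<Rightarrow> ratfun"
    using sum.inter_filter[OF fin, of f Q] by (simp add: conj_assoc)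
  have one: "{R. R \<in> cuts n \<and> compat (first R) {1..n} L \<and> card R = 1} = {{1}}"
  proof -
    have "R = {1}" if R: "R \<in> cuts n" "card R = 1" for R
      using cutsD(2)[OF R(1) n] R(2) by (metis card_1_singletonE singletonD)
    moreover have c: "{1} \<in> cuts n" using n by (simp add: cuts_def)
    moreover have "compat (first {1}) {1..n} L"
      unfolding compat_def using first_props(1)[OF c] by auto
    ultimately have "R \<in> cuts n \<and> compat (first R) {1..n} L \<and> card R = 1 \<longleftrightarrow> R = {1}" for R
      by (metis is_singletonI is_singleton_altdef)
    then show ?thesis by simp
  qed
  have "(\<Sum>R\<in>?X. mu R (rst L R))
    = (if cutpts n L = {} then 1 else 0) + (if cutpts n (L\<inverse>) = {} then 1 else 0) - 1
      - of_nat (if n \<ge> 2 \<and> cutpts n L = {} \<and> cutpts n (L\<inverse>) = {} then 1 else 0)"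
    unfolding mu_def sum_subtractf sum.distrib fil
      sum_increasing_quotients[OF L n] sum_decreasing_quotients[OF L n] one
      card_simple_quotients[OF L, symmetric]
    by simp
  \<comment> \<open>For \<open>n \<ge> 2\<close>, with \<open>a\<close> and \<open>b\<close> the
    values of the first two summands, the expression is
    \<open>a + b - 1 - a * b = - (1 - a) * (1 - b)\<close>. It vanishes because no order has cut
    points of both kinds.\<close>
  also have "\<dots> = (if n = 1 then 1 else 0)"
  proof (cases "n = 1")
    case True
    then have "cutpts n M = {}" for M by (auto simp: cutpts_def)
    then show ?thesis using True by simp
  next
    case False
    have "cutpts n L = {} \<or> cutpts n (L\<inverse>) = {}"
    proof (rule ccontr)
      assume "\<not> ?thesis"
      then obtain c d where c: "c \<in> cutpts n L" and d: "d \<in> cutpts n (L\<inverse>)" by blast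
      have "(1, n) \<in> L" "(1, n) \<in> L\<inverse>"
        using cutptsD[OF c, of 1 n] cutpts_range[OF c] cutptsD[OF d, of 1 n] cutpts_range[OF d] n
        by auto
      then show False using linords_asym[OF L] by auto
    qed
    then show ?thesis using False n by auto
  qed
  finally show ?thesis .
qed

lemma desc_self: "L \<in> linords A \<Longrightarrow> desc L L = 0"
proof -
  assume "L \<in> linords A"
  then have "covdesc L L = {}" using linords_asym[of L A] by (auto simp: covdesc_def)
  then show ?thesis by (simp add: desc_def)
qed

text \<open>Every pair of consecutive ranks is a descent; used for the decreasing permutation, in
  both directions, it yields the power of \<open>var_s * var_t\<close> in \<open>G\<close>.\<close>

lemma desc_converse:
  assumes L: "L \<in> linords A" and A: "finite A"
  shows "desc L (L\<inverse>) = card A - 1"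
proof -
  let ?h = "inv_into A (rank L A)"
  have h: "?h i \<in> A" "rank L A (?h i) = i" if "i \<in> {1..card A}" for i
    using that rank_bij[OF L A] by (auto simp: bij_betw_def inv_into_into f_inv_into_f)
  have "rank (L\<inverse>) A (?h i) > rank (L\<inverse>) A (?h (i + 1))" if "i \<in> {1..<card A}" for i
  proof -
    have i: "i \<in> {1..card A}" "i + 1 \<in> {1..card A}" using that by auto
    have "rank L A (?h i) < rank L A (?h (i + 1))" using h(2)[OF i(1)] h(2)[OF i(2)] by simp
    then have "(?h i, ?h (i + 1)) \<in> L" using rank_less_iff[OF L A h(1)[OF i(1)] h(1)[OF i(2)]] by simp
    then show ?thesis by (intro rank_less[OF linords_converse[OF L] A]) simp
  qed
  then have "{i \<in> {1..<card A}. rank (L\<inverse>) A (?h i) > rank (L\<inverse>) A (?h (i + 1))} = {1..<card A}"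
    by blast
  then show ?thesis unfolding desc_rank[OF L linords_converse[OF L] A] by simp
qed

subsection \<open>The compositional inverse\<close>

definition G :: "ratfun fps" where
  "G = Abs_fps (\<lambda>k. if k = 0 then 0
    else (- 1) ^ (k - 1) + (- (var_s * var_t)) ^ (k - 1)
      - (if k = 1 then 1 else 0) - (if k \<ge> 3 then simp_poly k else 0))"

text \<open>The increasing order has weight 1 and the decreasing one
  \<open>(var_s * var_t) ^ (card R - 1)\<close>; with their signs these are the two powers in
  \<open>G\<close>.\<close>

lemma G_nth_card:
  assumes R: "finite R" "R \<noteq> {}"
  shows "G $ card R = (\<Sum>M\<in>linords R. mu R M * wt R M)"
proof -
  note fin = finite_linords[OF R(1)]
  have p: "pos R \<in> linords R" "(pos R)\<inverse> \<in> linords R"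
    using pos_linords linords_converse by auto
  have w: "wt R (pos R) = 1" "wt R ((pos R)\<inverse>) = (var_s * var_t) ^ (card R - 1)"
    using desc_self[OF pos_linords] desc_converse[OF pos_linords R(1)] desc_converse[OF p(2) R(1)]
    by (simp_all add: wt_def power_mult_distrib)
  have F1: "(\<Sum>M\<in>linords R. if card R = 1 then wt R M else 0) = (if card R = 1 then 1 else 0)"
    using sum_wt_linords[OF R] F_nth_1 by auto
  have S: "(\<Sum>M\<in>linords R. if card R \<ge> 3 \<and> simple R M then wt R M else 0)
    = (if card R \<ge> 3 then simp_poly (card R) else 0)"
    using sum_wt_simple[OF R(1)] sum.inter_filter[OF fin, of "wt R" "simple R"] by auto
  have "mu R M * wt R M = (if M = pos R then (- 1) ^ (card R - 1) * wt R (pos R) else 0)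
    + (if M = (pos R)\<inverse> then (- 1) ^ (card R - 1) * wt R ((pos R)\<inverse>) else 0)
    - (if card R = 1 then wt R M else 0)
    - (if card R \<ge> 3 \<and> simple R M then wt R M else 0)" for M
    by (auto simp: mu_def algebra_simps)
  then have "(\<Sum>M\<in>linords R. mu R M * wt R M)
    = (- 1) ^ (card R - 1) * wt R (pos R) + (- 1) ^ (card R - 1) * wt R ((pos R)\<inverse>)
      - (if card R = 1 then 1 else 0) - (if card R \<ge> 3 then simp_poly (card R) else 0)"
    using p by (simp only: sum_subtractf sum.distrib F1 S sum.delta[OF fin] if_True)
  also have "\<dots> = G $ card R"
    using R w by (simp add: G_def power_mult_distrib[symmetric])
  finally show ?thesis ..
qed

lemma G_compose_F: "G oo F = fps_X"
proof (rule fps_ext)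
  fix n show "(G oo F) $ n = fps_X $ n"
  proof (cases "n = 0")
    case True
    then show ?thesis by (simp add: G_def)
  next
    case False
    then have n: "n > 0" by simp
    have "(G oo F) $ n = (\<Sum>L\<in>linords {1..n}. (if n = 1 then 1 else 0) * wt {1..n} L)"
    proof -
      have "(G oo F) $ n = (\<Sum>L\<in>linords {1..n}.
        (\<Sum>R | R \<in> cuts n \<and> compat (first R) {1..n} L. mu R (rst L R)) * wt {1..n} L)"
        by (rule compose_F_nth[OF n]) (rule G_nth_card)
      also have "\<dots> = (\<Sum>L\<in>linords {1..n}. (if n = 1 then 1 else 0) * wt {1..n} L)"
        by (rule sum.cong[OF refl]) (simp only: sum_mu_quotients[OF _ n])
      finally show ?thesis .
    qed
    also have "\<dots> = (if n = 1 then \<Sum>L\<in>linords {1..n}. wt {1..n} L else 0)" by simp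
    also have "\<dots> = fps_X $ n"
      using sum_wt_linords[of "{1..n}"] F_nth_1 n by (cases "n = 1") simp_all
    finally show ?thesis .
  qed
qed

text \<open>\<open>G\<close> is so far a left inverse of \<open>F\<close>; associativity of
  composition identifies it with the two-sided inverse.\<close>

lemma fps_inv_F_eq: "fps_inv F = G"
proof -
  have "G = G oo (F oo fps_inv F)" by (simp add: fps_inv_F(2))
  also have "\<dots> = (G oo F) oo fps_inv F"
    by (rule fps_compose_assoc) (simp_all add: F_nth_0 fps_inv_def)
  also have "\<dots> = fps_inv F" 
    by (simp add: G_compose_F fps_X_fps_compose_startby0 fps_inv_def)
  finally show ?thesis ..
qed

theorem corollary5p4:
  fixes n :: nat
  assumes "n \<ge> 4"
  shows "simp_poly n =
    - (fps_inv F $ n) + (-1) ^ (n - 1) + (- (var_s * var_t)) ^ (n - 1)"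
  \<comment> \<open>In these degrees the correction for degree 1 is zero and the term
    \<open>simp_poly n\<close> is present, so the coefficient of \<open>G\<close> can be solved for
    it.\<close>
  using assms by (simp add: fps_inv_F_eq G_def)

end
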